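(* Let $d \in \{5,6,7,8\}$ and, for a positive integer $v$, let $f_d : [0,v] \to \mathbb{R}$ be the piecewise linear function given by \[ f_5(u) = \begin{cases} 2u & 0 \leq u \leq 3v/20,\\ 4u/3 + v/10 & 3v/20 \leq u \leq 3v/10,\\ u + v/5 & 3v/10 \leq u \leq v/2,\\ 3u/4 + 13v/40 & v/2 \leq u \leq 7v/10,\\ u/2 + v/2 & 7v/10 \leq u \leq v, \end{cases} \] \[ f_6(u) = \begin{cases} 5u/2 & 0 \leq u \leq v/10,\\ 5u/3 + v/12 & v/10 \leq u \leq v/4,\\ u + v/4 & v/4 \leq u \leq v/2,\\ 3u/5 + 9v/20 & v/2 \leq u \leq 3v/4,\\ 2u/5 + 3v/5 & 3v/4 \leq u \leq v, \end{cases} \] \[ f_7(u) = \begin{cases} 3u & 0 \leq u \leq v/10,\\ 2u + v/10 & v/10 \leq u \leq 3v/20,\\ 21u/15 + 19v/100 & 3v/20 \leq u \leq 3v/10,\\ u + 31v/100 & 30v/100 \leq u \leq 39v/100,\\ 15u/21 + 59v/140 & 39v/100 \leq u \leq 3v/5,\\ u/2 + 11v/20 & 3v/5 \leq u \leq 7v/10,\\ u/3 + 2v/3 & 7v/10 \leq u \leq v, \end{cases} \] \[ f_8(u) = \begin{cases} 3u & 0 \leq u \leq v/10,\\ 2u + v/10 & v/10 \leq u \leq v/5,\\ 5u/4 + v/4 & v/5 \leq u \leq v/3,\\ 4u/5 + 2v/5 & v/3 \leq u \leq v/2,\\ u/2 + 11v/20 & v/2 \leq u \leq 7v/10,\\ u/3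 + 2v/3 & 7v/10 \leq u \leq v. \end{cases} \] Then for every $d \in \{5,6,7,8\}$ there is an integer $v_0$ such that for every integer $v \geq v_0$ there exists a bipartite $d$-regular multigraph on $2v$ nodes, with node sets $V$ and $W$ (the two sides of the bipartition), having the following property: for every $U \subseteq V$ and for every $U \subseteq W$, the cardinality of the set of neighbours of $U$ is at least $f_d(|U|)$.
   Context: A multigraph may have several parallel edges between the same pair of nodes. It is bipartite with node sets $V$ and $W$ if every edge joins a node of $V$ to a node of $W$, and $d$-regular if every node is incident to exactly $d$ edges, counted with multiplicity (so $|V| = |W| = v$ when there are $2v$ nodes and $d \geq 1$). The set of neighbours of $U \subseteq V$ is the set of distinct nodes of $W$ joined by at least one edge to some node of $U$; for $U \subseteq W$ it is defined symmetrically as a subset of $V$. *)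

theory Defs
  imports Complex_Main "HOL-Library.Multiset"
begin

text \<open>
  An edge is the two-element set of its end nodes; parallel edges are repeated elements of the
  multiset of edges. There are no loops.
\<close>

record 'a multigraph =
  nodes :: "'a set"
  edges :: "'a set multiset"

definition multigraph :: "'a multigraph \<Rightarrow> bool" where
  "multigraph G \<longleftrightarrow>
     finite (nodes G) \<and> (\<forall>e \<in># edges G. e \<subseteq> nodes G \<and> card e = 2)"

definition bipartite :: "'a multigraph \<Rightarrow> 'a set \<Rightarrow> 'a set \<Rightarrow> bool" where
  "bipartite G V W \<longleftrightarrow>
     nodes G = V \<union> W \<and> V \<inter> W = {} \<and>
     (\<forall>e \<in># edges G. \<exists>x \<in> V. \<exists>y \<in> W. e = {x, y})"

definition degree :: "'a multigraph \<Rightarrow> 'a \<Rightarrow> nat" where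
  "degree G x = size {#e \<in># edges G. x \<in> e#}"

definition regular :: "'a multigraph \<Rightarrow> nat \<Rightarrow> bool" where
  "regular G d \<longleftrightarrow> (\<forall>x \<in> nodes G. degree G x = d)"

text \<open>
  If \<open>G\<close> is bipartite with node sets \<open>V\<close> and \<open>W\<close>, then the neighbours of a subset of
  one of the two sides automatically lie in the other side.
\<close>

definition neighbours :: "'a multigraph \<Rightarrow> 'a set \<Rightarrow> 'a set" where
  "neighbours G U = {y \<in> nodes G. \<exists>x \<in> U. {x, y} \<in># edges G}"

text \<open>
  The following functions are meant for \<open>0 \<le> u \<le> v\<close>. Adjacent linear pieces agree at their
  common breakpoint, so the order in which the cases are tested does not matter there.
\<close>

definition f5 :: "real \<Rightarrow> real \<Rightarrow> real" where
  "f5 v u =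
    (if u \<le> 3 * v / 20 then 2 * u
     else if u \<le> 3 * v / 10 then 4 * u / 3 + v / 10
     else if u \<le> v / 2 then u + v / 5
     else if u \<le> 7 * v / 10 then 3 * u / 4 + 13 * v / 40
     else u / 2 + v / 2)"

definition f6 :: "real \<Rightarrow> real \<Rightarrow> real" where
  "f6 v u =
    (if u \<le> v / 10 then 5 * u / 2
     else if u \<le> v / 4 then 5 * u / 3 + v / 12
     else if u \<le> v / 2 then u + v / 4
     else if u \<le> 3 * v / 4 then 3 * u / 5 + 9 * v / 20
     else 2 * u / 5 + 3 * v / 5)"

definition f7 :: "real \<Rightarrow> real \<Rightarrow> real" where
  "f7 v u =
    (if u \<le> v / 10 then 3 * u
     else if u \<le> 3 * v / 20 then 2 * u + v / 10
     else if u \<le> 3 * v / 10 then 21 * u / 15 + 19 * v / 100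
     else if u \<le> 39 * v / 100 then u + 31 * v / 100
     else if u \<le> 3 * v / 5 then 15 * u / 21 + 59 * v / 140
     else if u \<le> 7 * v / 10 then u / 2 + 11 * v / 20
     else u / 3 + 2 * v / 3)"

definition f8 :: "real \<Rightarrow> real \<Rightarrow> real" where
  "f8 v u =
    (if u \<le> v / 10 then 3 * u
     else if u \<le> v / 5 then 2 * u + v / 10
     else if u \<le> v / 3 then 5 * u / 4 + v / 4
     else if u \<le> v / 2 then 4 * u / 5 + 2 * v / 5
     else if u \<le> 7 * v / 10 then u / 2 + 11 * v / 20
     else u / 3 + 2 * v / 3)"

definition f :: "nat \<Rightarrow> real \<Rightarrow> real \<Rightarrow> real" where
  "f d = (if d = 5 then f5 else if d = 6 then f6 else if d = 7 then f7
          else if d = 8 then f8 else undefined)"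

end

theory Submission
  imports Defs "HOL-Analysis.Analysis" "HOL-Real_Asymp.Real_Asymp"
begin

text \<open>
  Let \<open>d = a + 3\<close> and join \<open>x < v\<close> to \<open>v + p i x\<close> for \<open>d\<close> independent uniformly random permutations
  \<open>p i\<close> of \<open>{..<v}\<close>. A set \<open>U\<close> of \<open>u\<close> nodes on the left expands too little only if it is trapped:
  all \<open>p i\<close> map it into one set \<open>X\<close> of size \<open>w\<close>, where \<open>w\<close> is the largest integer below the required
  number. The expected number of such pairs \<open>(U, X)\<close> is
  \<open>E(u, w) = (v choose u) (v choose w) ((w choose u) / (v choose u))\<^sup>d\<close>.
  If instead \<open>U\<close> lies on the right and all its preimages lie in \<open>Y\<close>, then the complement of \<open>Y\<close> is
  trapped by the complement of \<open>U\<close>. So both sides are handled by traps with the sizes \<open>(u, w)\<close> and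
  \<open>(v - w, v - u)\<close>, and \<open>E\<close> takes the same value at both (\<open>expected_traps_dual\<close>). As fewer than
  \<open>2 v\<close> pairs of sizes occur, a bound \<open>E(u, w) \<le> C / v\<^sup>2\<close> with \<open>C\<close> independent of \<open>u\<close> leaves a positive
  probability that there is no trap (\<open>ex_permutations_without_traps\<close>).

  For this bound, scale \<open>v\<close> to \<open>1\<close>. The mirror map \<open>(x, y) \<mapsto> (1 - y, 1 - x)\<close> preserves the graph of each
  of the four functions, and by the duality of \<open>E\<close> it suffices to treat a part of the graph that
  covers all of it together with its mirror image. This part starts at the origin and satisfies
  \<open>y \<le> a x\<close>. Sets with \<open>u \<le> \<delta> v\<close> are treated by the elementary estimate
  \<open>E(u, w) \<le> (C' (u / v)\<^sup>2)\<^sup>u\<close> (\<open>expected_traps_le_small\<close>), where the exponent \<open>2\<close> is \<open>d - 1 - a\<close>. For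
  the other sets, factorials are replaced by \<open>n\<^sup>n e\<^sup>-\<^sup>n\<close>, which gives
  \<open>E(u, w) \<le> exp (v \<cdot> rate (u / v, w / v) + O(log v))\<close> (\<open>expected_traps_le_rate\<close>), and it remains to
  see that the rate is negative on the curve away from the origin; compactness then gives a
  uniform exponential decay that also absorbs the rounding of \<open>w\<close>.

  Along each linear piece the rate is a convex function of the parameter, so it lies below its
  chord and only its values at the breakpoints matter (\<open>rate_neg_on_segment\<close>). Breakpoints are
  rational, and at a rational point the sign of the rate compares two products of powers of
  natural numbers (\<open>rate_neg_by_powers\<close>).
\<close>

section \<open>Random permutations and the union bound\<close>

lemma ex_permutation_mapping:
  assumes "finite S" "Y \<subseteq> S" "Z \<subseteq> S" "card Y = card Z"
  shows "\<exists>q. q permutes S \<and> q ` Y = Z"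
proof -
  have fY: "finite Y" "finite Z" "finite (S - Y)" "finite (S - Z)" using assms finite_subset by auto
  obtain g where g: "bij_betw g Y Z" using assms fY finite_same_card_bij by blast
  have "card (S - Y) = card (S - Z)" using assms fY by (simp add: card_Diff_subset)
  then obtain h where h: "bij_betw h (S - Y) (S - Z)" using fY finite_same_card_bij by blast
  define q where "q x = (if x \<in> Y then g x else if x \<in> S then h x else x)" for x
  have "bij_betw q Y Z" using g by (rule bij_betw_cong[THEN iffD1, rotated]) (simp add: q_def)
  moreover have "bij_betw q (S - Y) (S - Z)" using h
    by (rule bij_betw_cong[THEN iffD1, rotated]) (simp add: q_def)
  ultimately have "bij_betw q (Y \<union> (S - Y)) (Z \<union> (S - Z))"
    by (rule bij_betw_combine) auto
  hence "bij_betw q S S" using assms by (simp add: Un_absorb1)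
  moreover have "q x = x" if "x \<notin> S" for x using that assms by (auto simp: q_def)
  ultimately have "q permutes S" by (rule bij_imp_permutes)
  moreover have "q ` Y = Z" using \<open>bij_betw q Y Z\<close> by (simp add: bij_betw_def)
  ultimately show ?thesis by blast
qed

text \<open>
  The number of permutations that map \<open>U\<close> onto \<open>Y\<close> depends only on the size of \<open>Y\<close>, because
  composition with a permutation that takes \<open>Y\<close> to \<open>Y'\<close> injects one set of permutations into the
  other. All \<open>card S choose card U\<close> possible images therefore have an equal share of the permutations.
\<close>
lemma card_permutations_image_eq:
  assumes "finite S" "U \<subseteq> S" "Y \<subseteq> S" "card Y = card U"
  shows "card {p. p permutes S \<and> p ` U = Y} * (card S choose card U) = fact (card S)"
proof -
  let ?N = "\<lambda>Z. {p. p permutes S \<and> p ` U = Z}"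
  let ?T = "{Z. Z \<subseteq> S \<and> card Z = card U}"
  have fin: "finite (?N Z)" for Z
    by (rule finite_subset[OF _ finite_permutations[OF assms(1)]]) auto
  have le: "card (?N Z) \<le> card (?N Z')" if Z: "Z \<in> ?T" "Z' \<in> ?T" for Z Z'
  proof -
    obtain q where q: "q permutes S" "q ` Z = Z'" using ex_permutation_mapping[of S Z Z'] assms(1) Z by auto
    show ?thesis
    proof (rule card_inj_on_le[of "\<lambda>p. q \<circ> p"])
      show "inj_on (\<lambda>p. q \<circ> p) (?N Z)"
        using permutes_inj[OF q(1)] by (auto simp: inj_on_def fun_eq_iff dest: injD)
      show "(\<lambda>p. q \<circ> p) ` ?N Z \<subseteq> ?N Z'"
        using q by (auto simp: permutes_compose image_comp[symmetric])
    qed (rule fin)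
  qed
  have fT: "finite ?T" using assms(1) by (auto intro: finite_subset[of _ "Pow S"])
  have "{p. p permutes S} = (\<Union>Z\<in>?T. ?N Z)"
    using assms(2) by (auto simp: card_image permutes_inj_on permutes_in_image subset_iff)
  hence "fact (card S) = card (\<Union>Z\<in>?T. ?N Z)"
    using card_permutations[OF refl assms(1)] by simp
  also have "\<dots> = (\<Sum>Z\<in>?T. card (?N Z))"
    by (rule card_UN_disjoint) (use fT fin in auto)
  also have "\<dots> = (\<Sum>Z\<in>?T. card (?N Y))"
    by (rule sum.cong) (use le assms in \<open>auto intro!: antisym\<close>)
  also have "\<dots> = card (?N Y) * (card S choose card U)"
    using n_subsets[OF assms(1), of "card U"] by simp
  finally show ?thesis by simp
qed

lemma card_permutations_image_subset:
  assumes "finite S" "U \<subseteq> S" "X \<subseteq> S"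
  shows "card {p. p permutes S \<and> p ` U \<subseteq> X} * (card S choose card U)
       = (card X choose card U) * fact (card S)"
proof -
  let ?N = "\<lambda>Z. {p. p permutes S \<and> p ` U = Z}"
  let ?T = "{Z. Z \<subseteq> X \<and> card Z = card U}"
  have fX: "finite X" using assms finite_subset by auto
  have fin: "finite (?N Z)" for Z
    by (rule finite_subset[OF _ finite_permutations[OF assms(1)]]) auto
  have fT: "finite ?T" using fX by (auto intro: finite_subset[of _ "Pow X"])
  have "{p. p permutes S \<and> p ` U \<subseteq> X} = (\<Union>Z\<in>?T. ?N Z)"
    by (auto simp: card_image permutes_inj_on)
  hence "card {p. p permutes S \<and> p ` U \<subseteq> X} = card (\<Union>Z\<in>?T. ?N Z)"
    by simp
  also have "\<dots> = (\<Sum>Z\<in>?T. card (?N Z))"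
    by (rule card_UN_disjoint) (use fT fin in auto)
  finally have "card {p. p permutes S \<and> p ` U \<subseteq> X} * (card S choose card U)
    = (\<Sum>Z\<in>?T. card (?N Z) * (card S choose card U))" by (simp add: sum_distrib_right)
  also have "\<dots> = (\<Sum>Z\<in>?T. fact (card S))"
    by (intro sum.cong refl card_permutations_image_eq) (use assms in auto)
  finally show ?thesis using n_subsets[OF fX, of "card U"] by simp
qed

text \<open>
  The expected number of pairs \<open>(U, X)\<close> of sizes \<open>u\<close> and \<open>w\<close> such that \<open>d\<close> independent uniformly
  random permutations of \<open>{..<v}\<close> all map \<open>U\<close> into \<open>X\<close>.
\<close>
definition expected_traps :: "nat \<Rightarrow> nat \<Rightarrow> nat \<Rightarrow> nat \<Rightarrow> real" where
  "expected_traps d v u w = real (v choose u) * real (v choose w) * (real (w choose u) / real (v choose u)) ^ d"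

text \<open>
  A permutation maps \<open>U\<close> into \<open>X\<close> if and only if its inverse maps the complement of \<open>X\<close> into the
  complement of \<open>U\<close>, and a random permutation has the same distribution as its inverse.
\<close>
lemma expected_traps_dual:
  assumes "u \<le> w" "w \<le> v"
  shows "expected_traps d v (v - w) (v - u) = expected_traps d v u w"
proof -
  have "(v choose w) * (w choose u) = (v choose u) * ((v - u) choose (w - u))"
    using choose_mult[OF assms] .
  moreover have "((v - u) choose (w - u)) = ((v - u) choose (v - w))"
    using binomial_symmetric[of "w - u" "v - u"] assms by simp
  ultimately have "real (v choose w) * real (w choose u) = real (v choose u) * real ((v - u) choose (v - w))"
    by (metis of_nat_mult)
  moreover have "real (v choose w) > 0" "real (v choose u) > 0" using assms by simp_all
  ultimately have "real ((v - u) choose (v - w)) / real (v choose w) = real (w choose u) / real (v choose u)"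
    by (simp add: field_simps)
  moreover have "v choose (v - w) = v choose w" "v choose (v - u) = v choose u"
    using assms binomial_symmetric[of w v] binomial_symmetric[of u v] by auto
  ultimately show ?thesis by (simp add: expected_traps_def)
qed

text \<open>
  The first moment method, carried out by counting \<open>d\<close>-tuples of permutations: those with a trap of
  given sizes \<open>(u, w)\<close> number at most \<open>expected_traps d v u w\<close> times \<open>(v!)\<^sup>d\<close>.
\<close>
lemma ex_permutations_without_traps:
  assumes B: "finite B" "\<And>u w. (u, w) \<in> B \<Longrightarrow> u \<le> v"
    and sum: "(\<Sum>(u, w)\<in>B. expected_traps d v u w) < 1"
  shows "\<exists>p. (\<forall>i<d. p i permutes {..<v}) \<and>
    (\<forall>U X. U \<subseteq> {..<v} \<longrightarrow> X \<subseteq> {..<v} \<longrightarrow> (card U, card X) \<in> B \<longrightarrow> (\<exists>i<d. \<not> p i ` U \<subseteq> X))"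
proof -
  define S where "S = {..<v}"
  have S: "finite S" "card S = v" by (simp_all add: S_def)
  define \<Omega> where "\<Omega> = PiE {..<d} (\<lambda>_. {p. p permutes S})"
  define bad where "bad U X = PiE {..<d} (\<lambda>_. {p. p permutes S \<and> p ` U \<subseteq> X})" for U X
  define sets where "sets u w = {U. U \<subseteq> S \<and> card U = u} \<times> {X. X \<subseteq> S \<and> card X = w}" for u w
  have card_\<Omega>: "card \<Omega> = fact v ^ d"
    by (simp add: \<Omega>_def card_PiE card_permutations[OF S(2) S(1)])
  have card_bad: "real (card (bad U X)) =
      (real (card X choose card U) / real (v choose card U)) ^ d * fact v ^ d"
    if "U \<subseteq> S" "X \<subseteq> S" for U X
  proof -
    have "card U \<le> v" using that S card_mono by blast
    hence pos: "real (v choose card U) > 0" by simp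
    have "real (card {p. p permutes S \<and> p ` U \<subseteq> X}) * real (v choose card U)
       = real (card X choose card U) * fact v"
      using arg_cong[OF card_permutations_image_subset[OF S(1) that], of real] S(2) by simp
    hence "real (card {p. p permutes S \<and> p ` U \<subseteq> X}) =
       real (card X choose card U) / real (v choose card U) * fact v"
      using pos by (simp add: field_simps)
    thus ?thesis by (simp only: bad_def card_PiE finite_lessThan prod_constant card_lessThan of_nat_power power_mult_distrib)
  qed
  have fsets: "finite (sets u w)" for u w
    unfolding sets_def using S(1) by (auto intro: finite_subset[of _ "Pow S"])
  have "real (card (\<Union>(u,w)\<in>B. \<Union>(U,X)\<in>sets u w. bad U X)) \<le>
     (\<Sum>(u,w)\<in>B. \<Sum>(U,X)\<in>sets u w. real (card (bad U X)))"
  proof -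
    have "card (\<Union>(u,w)\<in>B. \<Union>(U,X)\<in>sets u w. bad U X) \<le>
      (\<Sum>b\<in>B. card (case b of (u,w) \<Rightarrow> \<Union>(U,X)\<in>sets u w. bad U X))"
      by (rule card_UN_le[OF B(1)])
    also have "\<dots> \<le> (\<Sum>(u,w)\<in>B. \<Sum>(U,X)\<in>sets u w. card (bad U X))"
    proof (rule sum_mono)
      fix b assume "b \<in> B"
      show "card (case b of (u,w) \<Rightarrow> \<Union>(U,X)\<in>sets u w. bad U X)
        \<le> (case b of (u,w) \<Rightarrow> \<Sum>(U,X)\<in>sets u w. card (bad U X))"
        using card_UN_le[OF fsets, of "\<lambda>(U,X). bad U X"]
        by (auto simp: case_prod_beta split: prod.split)
    qed
    finally have "real (card (\<Union>(u,w)\<in>B. \<Union>(U,X)\<in>sets u w. bad U X)) \<le>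
      real (\<Sum>(u,w)\<in>B. \<Sum>(U,X)\<in>sets u w. card (bad U X))" by (rule of_nat_mono)
    thus ?thesis by (simp add: case_prod_beta)
  qed
  also have "\<dots> = (\<Sum>(u,w)\<in>B. expected_traps d v u w) * fact v ^ d"
    unfolding sum_distrib_right
  proof (rule sum.cong[OF refl], clarify)
    fix u w
    have "(\<Sum>(U,X)\<in>sets u w. real (card (bad U X))) =
      (\<Sum>(U,X)\<in>sets u w. (real (w choose u) / real (v choose u)) ^ d * fact v ^ d)"
      by (rule sum.cong) (auto simp: sets_def card_bad)
    also have "\<dots> = expected_traps d v u w * fact v ^ d"
      by (simp add: sets_def card_cartesian_product n_subsets S expected_traps_def case_prod_beta)
    finally show "(\<Sum>(U,X)\<in>sets u w. real (card (bad U X))) = expected_traps d v u w * fact v ^ d" .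
  qed
  also have "\<dots> < 1 * fact v ^ d" by (rule mult_strict_right_mono[OF sum]) simp
  also have "\<dots> = real (card \<Omega>)" by (simp add: card_\<Omega>)
  finally have lt: "card (\<Union>(u,w)\<in>B. \<Union>(U,X)\<in>sets u w. bad U X) < card \<Omega>" by simp
  have "finite \<Omega>" unfolding \<Omega>_def using finite_permutations[OF S(1)] by (simp add: finite_PiE)
  have "finite (bad U X)" for U X
    unfolding bad_def
    by (rule finite_PiE) (auto intro: finite_subset[OF _ finite_permutations[OF S(1)]])
  hence "finite (\<Union>(u,w)\<in>B. \<Union>(U,X)\<in>sets u w. bad U X)"
    using B(1) fsets by (auto simp: case_prod_beta)
  hence "\<not> \<Omega> \<subseteq> (\<Union>(u,w)\<in>B. \<Union>(U,X)\<in>sets u w. bad U X)"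
    using lt card_mono by (meson not_le)
  then obtain p where p: "p \<in> \<Omega>" "p \<notin> (\<Union>(u,w)\<in>B. \<Union>(U,X)\<in>sets u w. bad U X)" by blast
  have perm: "p i permutes S" if "i < d" for i using p(1) that by (auto simp: \<Omega>_def)
  have "\<exists>i<d. \<not> p i ` U \<subseteq> X" if UX: "U \<subseteq> S" "X \<subseteq> S" "(card U, card X) \<in> B" for U X
  proof (rule ccontr)
    assume "\<not> ?thesis"
    hence "p \<in> bad U X" using p(1) by (auto simp: bad_def \<Omega>_def PiE_iff)
    thus False using p(2) UX by (force simp: sets_def)
  qed
  thus ?thesis using perm unfolding S_def by (intro exI[of _ p]) simp
qed

section \<open>The expected number of traps for small sets\<close>

definition xlogx :: "real \<Rightarrow> real" where "xlogx x = x * ln x"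

text \<open>
  Two-sided Stirling estimates without the constant; the upper one loses a logarithmic term, which
  is harmless against the exponential decay in \<open>v\<close>.
\<close>
lemma ln_fact_lower: "xlogx (real n) - real n \<le> ln (fact n)"
proof (induction n)
  case 0
  show ?case by (simp add: xlogx_def)
next
  case (Suc n)
  have "xlogx (real (Suc n)) - xlogx (real n) \<le> ln (real (Suc n)) + 1"
  proof (cases "n = 0")
    case False
    hence n: "real n > 0" by simp
    have "1 + 1 / real n = real (Suc n) / real n" using n by (simp add: field_simps)
    hence "ln (real (Suc n)) - ln (real n) = ln (1 + 1 / real n)"
      using n by (metis ln_divide_pos of_nat_0_less_iff zero_less_Suc)
    also have "\<dots> \<le> 1 / real n" using n by (intro ln_add_one_self_le_self) auto
    finally have "real n * (ln (real (Suc n)) - ln (real n)) \<le> 1"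
      using n by (simp add: field_simps)
    thus ?thesis by (simp add: xlogx_def algebra_simps)
  qed (simp add: xlogx_def)
  moreover have "ln (fact (Suc n)) = ln (real (Suc n)) + ln (fact n)"
    by (simp only: fact_Suc of_nat_mult of_nat_fact) (subst ln_mult, auto)
  ultimately show ?case using Suc by simp
qed

lemma ln_fact_upper: "ln (fact n) \<le> xlogx (real n) - real n + (ln (real n + 1) + 1)"
proof -
  have "ln (fact n) \<le> xlogx (real n) - real n + (ln (real n) + 1)" if "n \<ge> 1"
    using that
  proof (induction n rule: dec_induct)
    case base
    show ?case by (simp add: xlogx_def)
  next
    case (step n)
    hence n: "real n > 0" by simp
    have "1 + 1 / real n = inverse (1 - 1 / real (Suc n))" "1 + 1 / real n = real (Suc n) / real n"
      using n by (simp_all add: field_simps)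
    hence *: "ln (real (Suc n)) - ln (real n) = - ln (1 - 1 / real (Suc n))"
      using n by (metis ln_divide_pos ln_inverse of_nat_0_less_iff zero_less_Suc)
    have "ln (1 - 1 / real (Suc n)) \<le> - (1 / real (Suc n))"
      using n ln_add_one_self_le_self2[of "- (1 / real (Suc n))"] by (simp add: field_simps)
    hence "1 / real (Suc n) \<le> ln (real (Suc n)) - ln (real n)"
      using * by linarith
    hence "1 \<le> real (Suc n) * (ln (real (Suc n)) - ln (real n))"
      by (simp add: field_simps)
    moreover have "ln (fact (Suc n)) = ln (real (Suc n)) + ln (fact n)"
      by (simp only: fact_Suc of_nat_mult of_nat_fact) (subst ln_mult, auto)
    ultimately show ?case using step by (simp only: xlogx_def) (simp add: algebra_simps)
  qed
  note positive = this
  show ?thesis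
  proof (cases "n \<ge> 1")
    case True
    hence "ln (real n) \<le> ln (real n + 1)" by simp
    thus ?thesis using positive[OF True] by linarith
  next
    case False
    hence "n = 0" by simp
    thus ?thesis by (simp add: xlogx_def)
  qed
qed

lemma binomial_ratio_le:
  assumes "w \<le> v" "u \<le> v" "v > 0"
  shows "real (w choose u) / real (v choose u) \<le> (real w / real v) ^ u"
  using assms(2)
proof (induction u)
  case (Suc u)
  have rec: "real (n choose Suc u) = real (n choose u) * (real n - real u) / real (Suc u)" if "u \<le> n" for n
  proof -
    have "Suc u * (n choose Suc u) = (n - u) * (n choose u)"
      using binomial_absorb_comp[of n u] binomial_absorption[of u "n"] that
      by (metis Suc_times_binomial_eq binomial_absorption diff_Suc_1 times_binomial_minus1_eq)
    hence "real (Suc u) * real (n choose Suc u) = (real n - real u) * real (n choose u)"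
      using that by (metis of_nat_diff of_nat_mult)
    thus ?thesis by (simp add: field_simps)
  qed
  show ?case
  proof (cases "u < w")
    case False
    hence *: "w choose Suc u = 0" by simp
    show ?thesis unfolding * by simp
  next
    case True
    have "real (w choose Suc u) / real (v choose Suc u) =
      (real (w choose u) / real (v choose u)) * ((real w - real u) / (real v - real u))"
      using rec[of w] rec[of v] Suc.prems True by (simp del: of_nat_Suc binomial_Suc_Suc)
    also have "\<dots> \<le> (real w / real v) ^ u * (real w / real v)"
    proof (rule mult_mono)
      show "(real w - real u) / (real v - real u) \<le> real w / real v"
        using Suc.prems True assms by (simp add: field_simps mult_left_mono)
    qed (use Suc True in auto)
    finally show ?thesis by (simp only: power_Suc2)
  qed
qed simp

lemma binomial_le_exp:
  assumes "k > 0"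
  shows "real (n choose k) \<le> (exp 1 * real n / real k) ^ k"
proof -
  have "real k ^ k / exp (real k) \<le> fact k"
  proof -
    have "xlogx (real k) - real k \<le> ln (fact k)" by (rule ln_fact_lower)
    hence "exp (xlogx (real k) - real k) \<le> fact k" by (simp add: ln_ge_iff)
    moreover have "exp (xlogx (real k)) = real k ^ k"
      using assms by (simp add: xlogx_def exp_of_nat_mult)
    ultimately show ?thesis by (simp add: exp_diff)
  qed
  moreover have "real (n choose k) * fact k \<le> real n ^ k"
    using of_nat_mono[OF binomial_fact_pow[of n k], where 'a = real] by simp
  ultimately have "real (n choose k) * (real k ^ k / exp (real k)) \<le> real n ^ k"
    using mult_left_mono[of "real k ^ k / exp (real k)" "fact k" "real (n choose k)"] by linarith
  thus ?thesis using assms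
    by (simp add: power_mult_distrib power_divide field_simps exp_of_nat_mult[of k 1, simplified])
qed

text \<open>
  After \<open>(n choose k) \<le> (e n / k)\<^sup>k\<close> the power of \<open>w\<close> that remains is \<open>(w / v)\<close> to the \<open>d u - w\<close>. The
  base is at most \<open>a u / v \<le> 1\<close> and the exponent at least \<open>(d - a) u = 3 u\<close>; one of the three factors
  \<open>(u / v)\<^sup>u\<close> is spent on the number of sets \<open>U\<close>, and two remain.
\<close>
lemma expected_traps_le_small:
  assumes "0 < u" "u \<le> w" "w \<le> a * u" "a * u \<le> v"
  shows "expected_traps (a + 3) v u w \<le> (exp (real a + 1) * real a ^ 3 * (real u / real v)\<^sup>2) ^ u"
proof -
  have pos: "v > 0" "w > 0" "a > 0" "w \<le> v" "u \<le> v" using assms by (auto intro: Suc_leI gr0I)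
  define x where "x = real a * real u / real v"
  have x: "0 < x" "x \<le> 1" "real w / real v \<le> x" 
    using assms pos by (auto simp: x_def field_simps simp flip: of_nat_mult)
  have w': "w \<le> (a + 3) * u" "a * u \<le> (a+3) * u" using assms by (auto simp: algebra_simps)
  have le: "exp 1 ^ w * (real w / real v) ^ ((a + 3) * u - w) \<le> exp 1 ^ (a * u) * x ^ (3 * u)"
  proof (rule mult_mono)
    have "(real w / real v) ^ ((a + 3) * u - w) \<le> x ^ ((a + 3) * u - w)"
      using x by (intro power_mono) auto
    also have "\<dots> \<le> x ^ (3 * u)" using x assms by (intro power_decreasing) (auto simp: algebra_simps)
    finally show "(real w / real v) ^ ((a + 3) * u - w) \<le> x ^ (3 * u)" .
  qed (use assms in \<open>auto intro: power_increasing\<close>)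
  have "expected_traps (a + 3) v u w \<le>
    (exp 1 * real v / real u) ^ u * (exp 1 * real v / real w) ^ w * ((real w / real v) ^ u) ^ (a + 3)"
    unfolding expected_traps_def
    by (intro mult_mono power_mono binomial_le_exp binomial_ratio_le) (use pos assms in auto)
  also have "(exp 1 * real v / real w) ^ w * ((real w / real v) ^ u) ^ (a + 3)
     = exp 1 ^ w * (real w / real v) ^ ((a + 3) * u - w)"
  proof -
    have "((real w / real v) ^ u) ^ (a + 3) = (real w / real v) ^ w * (real w / real v) ^ ((a + 3) * u - w)"
      using w' by (simp flip: power_mult power_add add: mult.commute)
    thus ?thesis using pos by (simp add: power_mult_distrib power_divide)
  qed
  hence "(exp 1 * real v / real u) ^ u * (exp 1 * real v / real w) ^ w * ((real w / real v) ^ u) ^ (a + 3)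
    = (exp 1 * real v / real u) ^ u * (exp 1 ^ w * (real w / real v) ^ ((a + 3) * u - w))"
    by (simp only: mult.assoc)
  also have "\<dots> \<le> (exp 1 * real v / real u) ^ u * (exp 1 ^ (a * u) * x ^ (3 * u))"
    by (rule mult_left_mono[OF le]) simp
  also have "\<dots> = ((exp 1 * real v / real u) * (exp 1 ^ a * x ^ 3)) ^ u"
    by (simp only: power_mult power_mult_distrib)
  also have "(exp 1 * real v / real u) * (exp 1 ^ a * x ^ 3) = 
     exp (real a + 1) * real a ^ 3 * (real u / real v)\<^sup>2"
    using pos assms(1) by (simp add: x_def exp_add exp_of_nat_mult[of a 1, simplified] power3_eq_cube
      power2_eq_square field_simps)
  finally show ?thesis by simp
qed

text \<open>
  For \<open>u = 1\<close> the previous bound is of order \<open>v\<^sup>-\<^sup>2\<close>. Below \<open>\<delta> v\<close> the higher powers decay geometrically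
  in \<open>u\<close>: one factor \<open>(u / v)\<^sup>2\<close> is kept, the others are at most \<open>\<delta>\<^sup>2\<close>, and \<open>\<delta>\<close> is chosen so that the
  resulting \<open>4\<^sup>-\<^sup>u\<close> outweighs \<open>u\<^sup>2\<close>.
\<close>
lemma expected_traps_small:
  assumes "a \<ge> 1"
  shows "\<exists>\<delta>>0. \<forall>v u w. 0 < u \<longrightarrow> u \<le> w \<longrightarrow> w \<le> a * u \<longrightarrow> real u \<le> \<delta> * real v \<longrightarrow>
    expected_traps (a + 3) v u w \<le> 1 / \<delta>\<^sup>2 / (real v)\<^sup>2"
proof -
  define C where "C = exp (real a + 1) * real a ^ 3"
  have "real a ^ 3 > 0" "exp (real a + 1) \<ge> 1" using assms by simp_all
  hence "C > 0" by (simp add: C_def)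
  define \<delta> where "\<delta> = min (1 / real a) (1 / (4 * C + 1))"
  have "\<delta> > 0" using assms \<open>C > 0\<close> by (simp add: \<delta>_def)
  have "\<delta> \<le> 1 / real a" "\<delta> \<le> 1 / (4 * C + 1)" by (simp_all add: \<delta>_def)
  hence \<delta>: "real a * \<delta> \<le> 1" "\<delta> * (4 * C + 1) \<le> 1"
    using assms \<open>C > 0\<close> by (simp_all add: pos_le_divide_eq mult.commute)
  have "\<delta> \<le> 1 / real a" by (simp add: \<delta>_def)
  also have "\<dots> \<le> 1" using assms by simp
  finally have "\<delta> \<le> 1" .
  have "C * \<delta>\<^sup>2 \<le> C * \<delta>"
    using \<open>C > 0\<close> \<open>\<delta> > 0\<close> \<open>\<delta> \<le> 1\<close> by (simp add: power2_eq_square mult_left_le)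
  hence quarter: "C * \<delta>\<^sup>2 \<le> 1 / 4" using \<delta>(2) \<open>\<delta> > 0\<close> by (simp add: algebra_simps)
  have sq: "(real n)\<^sup>2 \<le> 4 ^ n" for n
  proof -
    have "real n \<le> 2 ^ n" using of_nat_less_two_power[of n] by (simp add: less_imp_le)
    hence "(real n)\<^sup>2 \<le> (2 ^ n)\<^sup>2" by (rule power_mono) simp
    also have "(2 ^ n)\<^sup>2 = (4 :: real) ^ n" by (simp flip: power_mult add: mult.commute[of n] power_mult)
    finally show ?thesis .
  qed
  show ?thesis
  proof (intro exI[of _ \<delta>] conjI allI impI)
    fix v u w
    assume u: "0 < u" "u \<le> w" "w \<le> a * u" "real u \<le> \<delta> * real v"
    have v: "v > 0" using u by (cases v) auto
    define q where "q = (real u / real v)\<^sup>2"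
    have "real a * real u \<le> (real a * \<delta>) * real v"
      using mult_left_mono[OF u(4), of "real a"] by simp
    also have "\<dots> \<le> 1 * real v" using \<delta> by (intro mult_right_mono) auto
    finally have "a * u \<le> v" by (simp flip: of_nat_mult)
    hence "expected_traps (a + 3) v u w \<le> (C * q) ^ u"
      using expected_traps_le_small[OF u(1-3)] by (simp add: C_def q_def)
    also have "\<dots> \<le> (1 / 4) ^ u * (q / \<delta>\<^sup>2)"
    proof -
      have "real u / real v \<le> \<delta>" using u v by (simp add: field_simps)
      hence q: "0 \<le> q" "q \<le> \<delta>\<^sup>2" by (auto simp: q_def intro: power_mono)
      have "C * q = C * \<delta>\<^sup>2 * (q / \<delta>\<^sup>2)" using \<open>\<delta> > 0\<close> by simp
      hence "(C * q) ^ u = (C * \<delta>\<^sup>2) ^ u * (q / \<delta>\<^sup>2) ^ u"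
        by (simp only: power_mult_distrib)
      also have "\<dots> \<le> (1 / 4) ^ u * (q / \<delta>\<^sup>2) ^ 1"
        using quarter q \<open>C > 0\<close> \<open>\<delta> > 0\<close> u(1)
        by (intro mult_mono power_mono power_decreasing) auto
      finally show ?thesis by simp
    qed
    also have "\<dots> = (real u)\<^sup>2 / 4 ^ u * (1 / \<delta>\<^sup>2 / (real v)\<^sup>2)"
      by (simp add: q_def power_divide)
    also have "\<dots> \<le> 1 * (1 / \<delta>\<^sup>2 / (real v)\<^sup>2)"
      using sq[of u] by (intro mult_right_mono) (auto simp: pos_divide_le_eq)
    finally show "expected_traps (a + 3) v u w \<le> 1 / \<delta>\<^sup>2 / (real v)\<^sup>2" by simp
  qed (rule \<open>\<delta> > 0\<close>)
qed

section \<open>The exponential rate\<close>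

text \<open>
  With \<open>H\<close> the binary entropy in natural logarithms this is
  \<open>H(u) + H(w) + d (w H(u / w) - H(u))\<close>, the exponential growth rate in \<open>v\<close> of the expected number of
  traps of sizes \<open>u v\<close> and \<open>w v\<close>. Written with \<open>x ln x\<close> it extends continuously to the boundary of
  the triangle \<open>0 \<le> u \<le> w \<le> 1\<close>.
\<close>
definition rate :: "real \<Rightarrow> real \<times> real \<Rightarrow> real" where
  "rate d = (\<lambda>(u, w). (d - 1) * xlogx w - xlogx (1 - w) - xlogx u + (d - 1) * xlogx (1 - u) - d * xlogx (w - u))"

lemma rate_dual: "rate d (1 - w, 1 - u) = rate d (u, w)"
  by (simp add: rate_def algebra_simps)

lemma continuous_on_xlogx: "continuous_on {0..} xlogx"
proof -
  have "(xlogx \<longlongrightarrow> xlogx 0) (at 0 within {0..})"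
  proof -
    have "((\<lambda>x::real. x * ln x) \<longlongrightarrow> 0) (at_right 0)" by real_asymp
    moreover have "at (0::real) within {0..} = at_right 0" 
      by (rule at_within_nhd[of _ UNIV]) auto
    ultimately show ?thesis by (simp add: xlogx_def[abs_def])
  qed
  moreover have "continuous (at x within {0..}) xlogx" if "x > 0" for x
    unfolding xlogx_def[abs_def] by (intro continuous_intros) (use that in auto)
  ultimately show ?thesis unfolding continuous_on_eq_continuous_within
    by (auto simp: continuous_within le_less)
qed

lemma continuous_on_rate: "continuous_on {(u, w). 0 \<le> u \<and> u \<le> w \<and> w \<le> 1} (rate d)"
proof -
  have *: "continuous_on {(u, w). 0 \<le> u \<and> u \<le> w \<and> w \<le> 1} (\<lambda>p. xlogx (g p))"
    if "continuous_on UNIV g" "\<And>u w. 0 \<le> u \<Longrightarrow> u \<le> w \<Longrightarrow> w \<le> 1 \<Longrightarrow> g (u, w) \<ge> 0" for g :: "real \<times> real \<Rightarrow> real"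
    by (rule continuous_on_compose2[OF continuous_on_xlogx])
       (use that continuous_on_subset[OF that(1)] in auto)
  have 1: "rate d = (\<lambda>p. (d - 1) * xlogx (snd p) - xlogx (1 - snd p) - xlogx (fst p)
     + (d - 1) * xlogx (1 - fst p) - d * xlogx (snd p - fst p))"
    by (simp add: rate_def fun_eq_iff case_prod_beta)
  show ?thesis unfolding 1
    by (intro continuous_intros *) auto
qed

text \<open>
  The terms with \<open>ln v\<close> cancel except for one multiple of \<open>v ln v\<close>, because the arguments of \<open>xlogx\<close>
  in the rate, weighted with their coefficients, add up to \<open>d - 2\<close>.
\<close>
lemma scaled_rate:
  assumes "v > 0" "0 \<le> u" "u \<le> w" "w \<le> v"
  shows "v * rate d (u / v, w / v) =
    (2 - d) * xlogx v + (d - 1) * xlogx w + (d - 1) * xlogx (v - u)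
      - xlogx (v - w) - xlogx u - d * xlogx (w - u)"
proof -
  have *: "v * xlogx (x / v) = xlogx x - x * ln v" if "x \<ge> 0" for x
    using that assms(1) by (cases "x = 0") (auto simp: xlogx_def ln_div algebra_simps)
  have "v * rate d (u / v, w / v) = (d - 1) * (v * xlogx (w / v)) - v * xlogx ((v - w) / v)
    - v * xlogx (u / v) + (d - 1) * (v * xlogx ((v - u) / v)) - d * (v * xlogx ((w - u) / v))"
    using assms(1) by (simp add: rate_def algebra_simps diff_divide_distrib)
  also have "\<dots> = (2 - d) * xlogx v + (d - 1) * xlogx w + (d - 1) * xlogx (v - u)
      - xlogx (v - w) - xlogx u - d * xlogx (w - u)"
    using assms by (simp add: * xlogx_def[of v] algebra_simps)
  finally show ?thesis .
qed

lemma ln_choose: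
  assumes "k \<le> n"
  shows "ln (real (n choose k)) = ln (fact n) - ln (fact k) - ln (fact (n - k))"
  by (simp add: binomial_fact[OF assms] ln_div ln_mult)

text \<open>
  Written in factorials, \<open>E(u, w) = v!\<^sup>2\<^sup>-\<^sup>d w!\<^sup>d\<^sup>-\<^sup>1 (v - u)!\<^sup>d\<^sup>-\<^sup>1 / ((v - w)! u! (w - u)!\<^sup>d)\<close>. In its logarithm the
  linear terms of Stirling's formula cancel, and the logarithmic error enters only through the
  \<open>2 (d - 1)\<close> factorials in the numerator.
\<close>
lemma expected_traps_le_rate:
  assumes "d \<ge> 2" "u \<le> w" "w \<le> v" "v > 0"
  shows "expected_traps d v u w \<le>
    exp (real v * rate (real d) (real u / real v, real w / real v)
       + 2 * (real d - 1) * (ln (real v + 1) + 1))"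
proof -
  define t where "t = ln (real v + 1) + 1"
  have pos: "real (v choose u) > 0" "real (v choose w) > 0" "real (w choose u) > 0"
    using assms by auto
  hence "expected_traps d v u w > 0" by (simp add: expected_traps_def)
  have up: "ln (fact n) \<le> xlogx (real n) - real n + t" if "n \<le> v" for n
  proof -
    have "ln (real n + 1) \<le> ln (real v + 1)" using that by simp
    thus ?thesis using ln_fact_upper[of n] unfolding t_def by linarith
  qed
  have "ln (expected_traps d v u w) = ln (real (v choose u)) + ln (real (v choose w))
     + d * (ln (real (w choose u)) - ln (real (v choose u)))"
    using pos by (simp add: expected_traps_def ln_mult ln_div ln_realpow)
  also have "\<dots> = - ((real d - 2) * ln (fact v)) + (real d - 1) * ln (fact w)
     + (real d - 1) * ln (fact (v - u)) - ln (fact (v - w)) - ln (fact u) - real d * ln (fact (w - u))"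
    using assms by (simp add: ln_choose algebra_simps)
  also have "\<dots> \<le> - ((real d - 2) * (xlogx (real v) - real v)) + (real d - 1) * (xlogx (real w) - real w + t)
     + (real d - 1) * (xlogx (real (v - u)) - real (v - u) + t) - (xlogx (real (v - w)) - real (v - w))
     - (xlogx (real u) - real u) - real d * (xlogx (real (w - u)) - real (w - u))"
    using assms by (intro add_mono diff_mono mult_left_mono up ln_fact_lower le_imp_neg_le) auto
  also have "\<dots> = real v * rate (real d) (real u / real v, real w / real v) + 2 * (real d - 1) * t"
    using assms by (subst scaled_rate) (auto simp: of_nat_diff algebra_simps)
  finally have "exp (ln (expected_traps d v u w)) \<le>
    exp (real v * rate (real d) (real u / real v, real w / real v) + 2 * (real d - 1) * t)" by simp
  thus ?thesis using \<open>expected_traps d v u w > 0\<close> by (simp add: t_def)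
qed

section \<open>Convexity of the rate along line segments\<close>

text \<open>
  Derivatives are required only in the open interval, since the rate has vertical tangents at the
  boundary of its domain and the first linear piece starts at the corner \<open>(0, 0)\<close>.
\<close>
lemma below_chord:
  fixes F :: "real \<Rightarrow> real"
  assumes cont: "continuous_on {0..1} F"
    and F': "\<And>t. 0 < t \<Longrightarrow> t < 1 \<Longrightarrow> (F has_real_derivative F' t) (at t)"
    and F'': "\<And>t. 0 < t \<Longrightarrow> t < 1 \<Longrightarrow> (F' has_real_derivative F'' t) (at t)"
    and nonneg: "\<And>t. 0 < t \<Longrightarrow> t < 1 \<Longrightarrow> F'' t \<ge> 0"
    and t: "0 < t" "t < 1"
  shows "F t \<le> (1 - t) * F 0 + t * F 1"
proof -
  have mvt: "\<exists>z>a. z < b \<and> F b - F a = (b - a) * F' z" if "0 \<le> a" "a < b" "b \<le> 1" for a b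
  proof -
    have "continuous_on {a..b} F" using cont by (rule continuous_on_subset) (use that in auto)
    moreover have "F differentiable (at x)" if "a < x" "x < b" for x
      using F'[of x] that \<open>0 \<le> a\<close> \<open>b \<le> 1\<close> real_differentiable_def by fastforce
    ultimately obtain l z where z: "a < z" "z < b" "DERIV F z :> l" "F b - F a = (b - a) * l"
      using MVT[OF \<open>a < b\<close>] by blast
    moreover have "l = F' z" using DERIV_unique[OF z(3) F'[of z]] z that by auto
    ultimately show ?thesis by blast
  qed
  obtain z1 where z1: "0 < z1" "z1 < t" "F t - F 0 = (t - 0) * F' z1" using mvt[of 0 t] t by auto
  obtain z2 where z2: "t < z2" "z2 < 1" "F 1 - F t = (1 - t) * F' z2" using mvt[of t 1] t by auto
  have "F' z1 \<le> F' z2"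
  proof (rule DERIV_nonneg_imp_nondecreasing[of z1 z2 F'])
    fix x assume "z1 \<le> x" "x \<le> z2"
    thus "\<exists>y. (F' has_real_derivative y) (at x) \<and> y \<ge> 0"
      using F''[of x] nonneg[of x] z1 z2 by auto
  qed (use z1 z2 in auto)
  hence "(1 - t) * (F t - F 0) \<le> t * (F 1 - F t)"
    using z1(3) z2(3) t by (simp add: mult_left_mono)
  thus ?thesis by (simp add: algebra_simps)
qed

lemma has_real_derivative_xlogx [derivative_intros]:
  assumes "(g has_real_derivative g') (at x)" "g x > 0"
  shows "((\<lambda>x. xlogx (g x)) has_real_derivative g' * (ln (g x) + 1)) (at x)"
  unfolding xlogx_def by (rule derivative_eq_intros assms refl)+ (use assms in \<open>auto simp: field_simps\<close>)

text \<open>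
  The assumption \<open>convex\<close> says that the second derivative of the rate along the segment is
  nonnegative, with the negative contributions on the left and the positive ones on the right.
\<close>
lemma rate_neg_on_segment:
  fixes x0 y0 x1 y1 d :: real
  assumes p0: "0 \<le> x0" "x0 \<le> y0" "y0 \<le> 1" and p1: "0 < x1" "x1 < y1" "y1 < 1"
    and convex: "\<And>t. 0 < t \<Longrightarrow> t < 1 \<Longrightarrow>
      (y1 - y0)\<^sup>2 / (1 - (y0 + t * (y1 - y0))) + (x1 - x0)\<^sup>2 / (x0 + t * (x1 - x0))
        + d * ((y1 - x1) - (y0 - x0))\<^sup>2 / ((y0 - x0) + t * ((y1 - x1) - (y0 - x0)))
      \<le> (d - 1) * (y1 - y0)\<^sup>2 / (y0 + t * (y1 - y0)) + (d - 1) * (x1 - x0)\<^sup>2 / (1 - (x0 + t * (x1 - x0)))"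
    and ends: "rate d (x0, y0) \<le> 0" "rate d (x1, y1) < 0"
    and p: "p \<in> closed_segment (x0, y0) (x1, y1)" "p \<noteq> (x0, y0)"
  shows "rate d p < 0"
proof -
  define a b where "a = x1 - x0" and "b = y1 - y0"
  define u w where "u t = x0 + t * a" and "w t = y0 + t * b" for t
  define F where "F t = rate d (u t, w t)" for t
  have lin: "u t = (1 - t) * x0 + t * x1" "w t - u t = (1 - t) * (y0 - x0) + t * (y1 - x1)"
     "1 - w t = (1 - t) * (1 - y0) + t * (1 - y1)" for t
    by (simp_all add: u_def w_def a_def b_def algebra_simps)
  have pos: "0 < u t" "0 < w t - u t" "0 < 1 - w t" if "0 < t" "t < 1" for t
  proof -
    have *: "0 < (1 - t) * c + t * e" if "0 \<le> c" "0 < e" for c e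
      using \<open>0 < t\<close> \<open>t < 1\<close> that by (intro add_nonneg_pos) auto
    show "0 < u t" "0 < w t - u t" "0 < 1 - w t"
      using *[of x0 x1] *[of "y0 - x0" "y1 - x1"] *[of "1 - y0" "1 - y1"] p0 p1 lin[of t] by auto
  qed
  have nonneg: "0 \<le> u t" "0 \<le> w t - u t" "0 \<le> 1 - w t" if "0 \<le> t" "t \<le> 1" for t
  proof -
    have *: "0 \<le> (1 - t) * c + t * e" if "0 \<le> c" "0 \<le> e" for c e
      using \<open>0 \<le> t\<close> \<open>t \<le> 1\<close> that by (intro add_nonneg_nonneg) auto
    show "0 \<le> u t" "0 \<le> w t - u t" "0 \<le> 1 - w t"
      using *[of x0 x1] *[of "y0 - x0" "y1 - x1"] *[of "1 - y0" "1 - y1"] p0 p1 lin[of t] by auto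
  qed
  have cont: "continuous_on {0..1} F"
    unfolding F_def using nonneg
    by (intro continuous_on_compose2[OF continuous_on_rate, of _ _ d] continuous_intros)
      (auto simp: u_def w_def intro!: continuous_intros)
  define F' where "F' t = (d - 1) * (b * (ln (w t) + 1)) + b * (ln (1 - w t) + 1) - a * (ln (u t) + 1)
    - (d - 1) * (a * (ln (1 - u t) + 1)) - d * ((b - a) * (ln (w t - u t) + 1))" for t
  define F'' where "F'' t = (d - 1) * b\<^sup>2 / w t - b\<^sup>2 / (1 - w t) - a\<^sup>2 / u t + (d - 1) * a\<^sup>2 / (1 - u t)
    - d * (b - a)\<^sup>2 / (w t - u t)" for t
  have du: "(u has_real_derivative a) (at t)" "(w has_real_derivative b) (at t)" for t
    unfolding u_def w_def by (auto intro!: derivative_eq_intros)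
  have pos': "0 < w t" "0 < 1 - u t" if "0 < t" "t < 1" for t
    using pos[OF that] by linarith+
  have dF: "(F has_real_derivative F' t) (at t)" if "0 < t" "t < 1" for t
    unfolding F_def rate_def prod.case
    by (rule derivative_eq_intros du pos[OF that] pos'[OF that] refl)+
      (simp add: F'_def algebra_simps)
  have dF': "(F' has_real_derivative F'' t) (at t)" if "0 < t" "t < 1" for t
    unfolding F'_def
    by (rule derivative_eq_intros du pos[OF that] pos'[OF that] refl)+
      (simp add: F''_def power2_eq_square mult_ac)
  have F'': "F'' t \<ge> 0" if "0 < t" "t < 1" for t
    using convex[OF that] by (simp add: F''_def a_def b_def u_def w_def algebra_simps)
  have ends': "F 0 \<le> 0" "F 1 < 0" using ends by (simp_all add: F_def u_def w_def a_def b_def)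
  have neg: "F t < 0" if "0 < t" "t \<le> 1" for t
  proof (cases "t = 1")
    case False
    hence "F t \<le> (1 - t) * F 0 + t * F 1"
      using below_chord[OF cont dF dF' F''] that by simp
    moreover have "(1 - t) * F 0 \<le> 0" "t * F 1 < 0"
      using that False ends' by (auto simp: mult_le_0_iff mult_less_0_iff)
    ultimately show ?thesis by linarith
  qed (use ends' in simp)
  obtain t where t: "0 \<le> t" "t \<le> 1" "p = (1 - t) *\<^sub>R (x0, y0) + t *\<^sub>R (x1, y1)"
    using p(1) by (auto simp: closed_segment_def)
  have "p = (u t, w t)" using t(3) by (simp add: u_def w_def a_def b_def algebra_simps)
  moreover have "t \<noteq> 0" using p(2) t(3) by auto
  ultimately show ?thesis using neg[of t] t by (simp add: F_def)
qed

text \<open>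
  If \<open>x\<close>, \<open>y\<close> and \<open>y - x\<close> all grow along the segment, each term of the second derivative is monotone,
  so it is enough to bound the terms at their less favourable endpoints. This leaves one rational
  inequality per segment.
\<close>
lemma rate_neg_on_inner_segment:
  fixes x0 y0 x1 y1 d :: real
  assumes d: "d \<ge> 1"
    and pts: "0 < x0" "x0 < y0" "x0 \<le> x1" "y0 \<le> y1" "y0 - x0 \<le> y1 - x1" "y1 < 1"
    and convex: "(y1 - y0)\<^sup>2 / (1 - y1) + (x1 - x0)\<^sup>2 / x0 + d * ((y1 - x1) - (y0 - x0))\<^sup>2 / (y0 - x0)
      \<le> (d - 1) * (y1 - y0)\<^sup>2 / y1 + (d - 1) * (x1 - x0)\<^sup>2 / (1 - x0)"
    and ends: "rate d (x0, y0) < 0" "rate d (x1, y1) < 0"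
    and p: "p \<in> closed_segment (x0, y0) (x1, y1)"
  shows "rate d p < 0"
proof (cases "p = (x0, y0)")
  case False
  show ?thesis
  proof (rule rate_neg_on_segment[OF _ _ _ _ _ _ _ _ _ p False])
    fix t :: real assume t: "0 < t" "t < 1"
    have grow: "c \<le> c + t * e" "c + t * e \<le> c + e" if "e \<ge> 0" for c e
      using that t by (auto simp: mult_left_le_one_le)
    have bounds: "x0 \<le> x0 + t * (x1 - x0)" "x0 + t * (x1 - x0) \<le> x1" "y0 + t * (y1 - y0) \<le> y1"
      "y0 \<le> y0 + t * (y1 - y0)" "y0 - x0 \<le> (y0 - x0) + t * ((y1 - x1) - (y0 - x0))"
      using grow[of "x1 - x0" x0] grow[of "y1 - y0" y0] grow[of "(y1 - x1) - (y0 - x0)" "y0 - x0"] pts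
      by simp_all
    have "(y1 - y0)\<^sup>2 / (1 - (y0 + t * (y1 - y0))) + (x1 - x0)\<^sup>2 / (x0 + t * (x1 - x0))
        + d * ((y1 - x1) - (y0 - x0))\<^sup>2 / ((y0 - x0) + t * ((y1 - x1) - (y0 - x0)))
      \<le> (y1 - y0)\<^sup>2 / (1 - y1) + (x1 - x0)\<^sup>2 / x0 + d * ((y1 - x1) - (y0 - x0))\<^sup>2 / (y0 - x0)"
      using bounds d pts by (intro add_mono divide_left_mono mult_pos_pos) auto
    also note convex
    also have "(d - 1) * (y1 - y0)\<^sup>2 / y1 + (d - 1) * (x1 - x0)\<^sup>2 / (1 - x0) \<le>
      (d - 1) * (y1 - y0)\<^sup>2 / (y0 + t * (y1 - y0)) + (d - 1) * (x1 - x0)\<^sup>2 / (1 - (x0 + t * (x1 - x0)))"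
      using bounds d pts by (intro add_mono divide_left_mono mult_pos_pos mult_nonneg_nonneg) auto
    finally show "(y1 - y0)\<^sup>2 / (1 - (y0 + t * (y1 - y0))) + (x1 - x0)\<^sup>2 / (x0 + t * (x1 - x0))
        + d * ((y1 - x1) - (y0 - x0))\<^sup>2 / ((y0 - x0) + t * ((y1 - x1) - (y0 - x0)))
      \<le> (d - 1) * (y1 - y0)\<^sup>2 / (y0 + t * (y1 - y0)) + (d - 1) * (x1 - x0)\<^sup>2 / (1 - (x0 + t * (x1 - x0)))" .
  qed (use pts ends in auto)
qed (use ends in simp)

text \<open>
  On a segment from the origin three terms of the second derivative are multiples of \<open>1 / t\<close>; their
  sum \<open>((d - 1) x - y) / t\<close> is nonnegative when the slope is at most \<open>d - 1\<close>, and it is smallest at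
  \<open>t = 1\<close>.
\<close>
lemma rate_neg_on_first_segment:
  fixes x y d :: real
  assumes d: "d \<ge> 1" and pts: "0 < x" "x < y" "y < 1" "y \<le> (d - 1) * x"
    and convex: "y\<^sup>2 / (1 - y) \<le> (d - 1) * x - y + (d - 1) * x\<^sup>2"
    and ends: "rate d (x, y) < 0"
    and p: "p \<in> closed_segment (0, 0) (x, y)" "p \<noteq> (0, 0)"
  shows "rate d p < 0"
proof (rule rate_neg_on_segment[OF _ _ _ _ _ _ _ _ _ p])
  fix t :: real assume t: "0 < t" "t < 1"
  have t': "t * y \<le> y" "t * x \<le> x" using t pts by (auto simp: mult_left_le_one_le)
  have pos: "0 < 1 - t * y" "0 < 1 - t * x" using t' pts by linarith+
  have "y\<^sup>2 / (1 - t * y) \<le> y\<^sup>2 / (1 - y)"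
    using t' pos pts by (intro divide_left_mono mult_pos_pos) simp_all
  also have "\<dots> \<le> (d - 1) * x - y + (d - 1) * x\<^sup>2" by (rule convex)
  also have "\<dots> \<le> ((d - 1) * x - y) / t + (d - 1) * x\<^sup>2 / (1 - t * x)"
  proof (rule add_mono)
    show "(d - 1) * x - y \<le> ((d - 1) * x - y) / t"
      using t pts by (simp add: pos_le_divide_eq mult_left_le)
    have "(d - 1) * x\<^sup>2 * (1 - t * x) \<le> (d - 1) * x\<^sup>2"
      using t d pts pos by (intro mult_left_le) auto
    thus "(d - 1) * x\<^sup>2 \<le> (d - 1) * x\<^sup>2 / (1 - t * x)"
      using pos by (simp add: pos_le_divide_eq)
  qed
  also have "((d - 1) * x - y) / t = (d - 1) * y\<^sup>2 / (t * y) - x\<^sup>2 / (t * x) - d * (y - x)\<^sup>2 / (t * (y - x))"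
    using t pts by (simp add: field_simps power2_eq_square)
  finally show "(y - 0)\<^sup>2 / (1 - (0 + t * (y - 0))) + (x - 0)\<^sup>2 / (0 + t * (x - 0))
        + d * ((y - x) - (0 - 0))\<^sup>2 / ((0 - 0) + t * ((y - x) - (0 - 0)))
      \<le> (d - 1) * (y - 0)\<^sup>2 / (0 + t * (y - 0)) + (d - 1) * (x - 0)\<^sup>2 / (1 - (0 + t * (x - 0)))"
    by simp
qed (use pts ends in \<open>auto simp: rate_def xlogx_def\<close>)

text \<open>The hypothesis is the exponentiated form of \<open>v \<cdot> rate < 0\<close>.\<close>
lemma rate_neg_by_powers:
  fixes d u w v :: nat
  assumes "d \<ge> 2" "0 < u" "u < w" "w < v"
    and "w ^ ((d - 1) * w) * (v - u) ^ ((d - 1) * (v - u))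
      < (v - w) ^ (v - w) * u ^ u * (w - u) ^ (d * (w - u)) * v ^ ((d - 2) * v)"
  shows "rate (real d) (real u / real v, real w / real v) < 0"
proof -
  have ln_pow: "ln (real (n ^ (c * n))) = real c * xlogx (real n)" if "n > 0" for n c
    using that by (simp add: xlogx_def ln_realpow)
  have ln_pow1: "ln (real (n ^ n)) = xlogx (real n)" for n
    using ln_pow[of n 1] by (cases "n = 0") (simp_all add: xlogx_def)
  have gt: "v > 0" "w > 0" "v - u > 0" "v - w > 0" "w - u > 0" using assms by auto
  have ln_mult': "ln (real (m * n)) = ln (real m) + ln (real n)" if "m > 0" "n > 0" for m n
    using that by (simp add: ln_mult)
  have "ln (real (w ^ ((d - 1) * w) * (v - u) ^ ((d - 1) * (v - u))))
     < ln (real ((v - w) ^ (v - w) * u ^ u * (w - u) ^ (d * (w - u)) * v ^ ((d - 2) * v)))"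
    using assms by (subst ln_less_cancel_iff) (simp_all only: of_nat_less_iff of_nat_0_less_iff, auto)
  also have "ln (real (w ^ ((d - 1) * w) * (v - u) ^ ((d - 1) * (v - u))))
    = real (d - 1) * xlogx w + real (d - 1) * xlogx (real (v - u))"
    using gt assms(2) by (simp only: ln_mult' ln_pow ln_pow1 zero_less_power nat_0_less_mult_iff)
  also have "ln (real ((v - w) ^ (v - w) * u ^ u * (w - u) ^ (d * (w - u)) * v ^ ((d - 2) * v)))
    = xlogx (real (v - w)) + xlogx u + real d * xlogx (real (w - u)) + real (d - 2) * xlogx v"
    using gt assms(2) by (simp only: ln_mult' ln_pow ln_pow1 zero_less_power nat_0_less_mult_iff)
  finally have "real v * rate (real d) (real u / real v, real w / real v) < 0"
    using assms by (subst scaled_rate) (auto simp: of_nat_diff algebra_simps)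
  thus ?thesis using assms by (simp add: mult_less_0_iff)
qed

section \<open>Subcritical points and segments\<close>

text \<open>
  What is needed of a point on the curve at degree \<open>a + 3\<close>: the slope bound serves small sets, the
  negative rate serves sets of linear size.
\<close>
definition subcritical :: "nat \<Rightarrow> real \<times> real \<Rightarrow> bool" where
  "subcritical a = (\<lambda>(x, y). 0 < x \<and> x < y \<and> y < 1 \<and> y \<le> real a * x \<and> rate (real a + 3) (x, y) < 0)"

lemma subcritical_bounds_on_segment:
  assumes "0 \<le> x0" "x0 \<le> y0" "y0 < 1" "y0 \<le> real a * x0" "subcritical a (x1, y1)"
    and "p \<in> closed_segment (x0, y0) (x1, y1)" "p \<noteq> (x0, y0)" "rate (real a + 3) p < 0"
  shows "subcritical a p"
proof -
  obtain t where t: "0 \<le> t" "t \<le> 1" "p = (1 - t) *\<^sub>R (x0, y0) + t *\<^sub>R (x1, y1)"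
    using assms by (auto simp: closed_segment_def)
  define x y where "x = (1 - t) * x0 + t * x1" and "y = (1 - t) * y0 + t * y1"
  have p: "p = (x, y)" using t(3) by (simp add: x_def y_def)
  have "t \<noteq> 0" using assms(7) t(3) by auto
  hence t: "t > 0" "t \<le> 1" using t by auto
  have *: "0 < (1 - t) * c + t * e" if "0 \<le> c" "0 < e" for c e
    using t that by (intro add_nonneg_pos) auto
  have **: "0 \<le> (1 - t) * c + t * e" if "0 \<le> c" "0 \<le> e" for c e
    using t that by (intro add_nonneg_nonneg) auto
  have "0 < x" "0 < y - x" "0 < 1 - y" "0 \<le> real a * x - y"
  proof -
    have ends: "0 < x1" "0 < y1 - x1" "0 < 1 - y1" "0 \<le> real a * x1 - y1"
      using assms(5) by (simp_all add: subcritical_def)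
    have "x = (1 - t) * x0 + t * x1" "y - x = (1 - t) * (y0 - x0) + t * (y1 - x1)"
      "1 - y = (1 - t) * (1 - y0) + t * (1 - y1)"
      "real a * x - y = (1 - t) * (real a * x0 - y0) + t * (real a * x1 - y1)"
      by (simp_all add: x_def y_def algebra_simps)
    thus "0 < x" "0 < y - x" "0 < 1 - y" "0 \<le> real a * x - y"
      using * ** ends assms(1-4) by simp_all
  qed
  thus ?thesis using assms p by (simp add: subcritical_def)
qed

lemma subcritical_inner_segment:
  assumes "subcritical a (x0, y0)" "subcritical a (x1, y1)"
    and "x0 \<le> x1" "y0 \<le> y1" "y0 - x0 \<le> y1 - x1"
    and "(y1 - y0)\<^sup>2 / (1 - y1) + (x1 - x0)\<^sup>2 / x0 + (real a + 3) * ((y1 - x1) - (y0 - x0))\<^sup>2 / (y0 - x0)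
      \<le> (real a + 2) * (y1 - y0)\<^sup>2 / y1 + (real a + 2) * (x1 - x0)\<^sup>2 / (1 - x0)"
    and p: "p \<in> closed_segment (x0, y0) (x1, y1)"
  shows "subcritical a p"
proof (cases "p = (x0, y0)")
  case False
  have "rate (real a + 3) p < 0"
    using assms(1-6) by (intro rate_neg_on_inner_segment[OF _ _ _ _ _ _ _ _ _ _ p])
      (auto simp: subcritical_def add.commute[of 2])
  thus ?thesis using assms False
    by (intro subcritical_bounds_on_segment[OF _ _ _ _ assms(2) p]) (auto simp: subcritical_def)
qed (use assms in simp)

lemma subcritical_first_segment:
  assumes "subcritical a (x, y)" "y\<^sup>2 / (1 - y) \<le> (real a + 2) * x - y + (real a + 2) * x\<^sup>2"
    and p: "p \<in> closed_segment (0, 0) (x, y)" "p \<noteq> (0, 0)"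
  shows "subcritical a p"
proof -
  have "rate (real a + 3) p < 0"
    using assms(1,2) by (intro rate_neg_on_first_segment[OF _ _ _ _ _ _ _ p])
      (auto simp: subcritical_def algebra_simps)
  thus ?thesis using assms
    by (intro subcritical_bounds_on_segment[OF _ _ _ _ assms(1) p]) (auto simp: subcritical_def)
qed

lemma subcritical_by_powers:
  fixes a u w v :: nat
  assumes "0 < u" "u < w" "w < v" "w \<le> a * u"
    and "w ^ ((a + 2) * w) * (v - u) ^ ((a + 2) * (v - u))
      < (v - w) ^ (v - w) * u ^ u * (w - u) ^ ((a + 3) * (w - u)) * v ^ ((a + 1) * v)"
  shows "subcritical a (real u / real v, real w / real v)"
proof -
  have "rate (real (a + 3)) (real u / real v, real w / real v) < 0"
    by (rule rate_neg_by_powers) (use assms in simp_all)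
  moreover have "real w \<le> real a * real u" using assms(4) by (simp flip: of_nat_mult)
  hence "real w / real v \<le> real a * (real u / real v)"
    using assms(3) by (simp add: divide_right_mono)
  moreover have "real w / real v < 1" "0 < real u / real v" "real u / real v < real w / real v"
    using assms(1-3) by (simp_all add: divide_strict_right_mono)
  ultimately show ?thesis by (simp add: subcritical_def)
qed


lemma subcritical_dual:
  assumes "subcritical a (x, y)" "1 - x \<le> real a * (1 - y)"
  shows "subcritical a (1 - y, 1 - x)"
  using assms by (simp add: subcritical_def rate_dual)

section \<open>A uniform bound near a subcritical curve\<close>

text \<open>
  The set sizes are integers and hit the curve only up to an error \<open>1 / v\<close>, so the negative upper
  bound that compactness gives on \<open>K\<close> is extended to a neighbourhood by uniform continuity.
\<close>
lemma rate_neg_near_compact: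
  assumes "compact K" and K: "\<And>p. p \<in> K \<Longrightarrow> subcritical a p"
  shows "\<exists>c>0. \<exists>\<eta>>0. \<forall>x y u w. (x, y) \<in> K \<longrightarrow> 0 \<le> u \<longrightarrow> u \<le> w \<longrightarrow> w \<le> 1 \<longrightarrow>
     \<bar>u - x\<bar> + \<bar>w - y\<bar> < \<eta> \<longrightarrow> rate (real a + 3) (u, w) \<le> - c"
proof (cases "K = {}")
  case True
  thus ?thesis by (auto intro: exI[of _ 1])
next
  case False
  define r where "r = rate (real a + 3)"
  define D where "D = {(u, w). 0 \<le> u \<and> u \<le> w \<and> w \<le> (1 :: real)}"
  have "D = ({0..1} \<times> {0..1}) \<inter> {p. fst p \<le> snd p}" by (auto simp: D_def)
  moreover have "closed {p :: real \<times> real. fst p \<le> snd p}"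
    by (intro closed_Collect_le continuous_intros)
  ultimately have "compact D" by (simp add: compact_Times compact_Int_closed)
  have cont: "continuous_on D r" unfolding D_def r_def by (rule continuous_on_rate)
  hence unif: "uniformly_continuous_on D r"
    using compact_uniformly_continuous \<open>compact D\<close> by blast
  have "K \<subseteq> D" using K by (force simp: D_def subcritical_def)
  obtain p0 where p0: "p0 \<in> K" "\<And>p. p \<in> K \<Longrightarrow> r p \<le> r p0"
    using continuous_attains_sup[OF \<open>compact K\<close> False] continuous_on_subset[OF cont \<open>K \<subseteq> D\<close>] by blast
  define c where "c = - r p0 / 2"
  have "c > 0" using K[OF p0(1)] by (auto simp: c_def r_def subcritical_def)
  then obtain \<eta> where \<eta>: "\<eta> > 0" "\<And>p q. p \<in> D \<Longrightarrow> q \<in> D \<Longrightarrow> dist q p < \<eta> \<Longrightarrow> dist (r q) (r p) < c"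
    using unif unfolding uniformly_continuous_on_def by metis
  have "r (u, w) \<le> - c" if "(x, y) \<in> K" "0 \<le> u" "u \<le> w" "w \<le> 1" "\<bar>u - x\<bar> + \<bar>w - y\<bar> < \<eta>" for x y u w
  proof -
    have "dist (u, w) (x, y) \<le> \<bar>u - x\<bar> + \<bar>w - y\<bar>"
      by (simp add: dist_Pair_Pair dist_real_def sqrt_sum_squares_le_sum_abs[of "u - x" "w - y", simplified])
    hence "dist (r (u, w)) (r (x, y)) < c"
      using \<eta>(2)[of "(x, y)" "(u, w)"] that \<open>K \<subseteq> D\<close> by (auto simp: D_def)
    moreover have "r (x, y) \<le> - 2 * c" using p0(2)[OF that(1)] by (simp add: c_def)
    ultimately show ?thesis by (simp add: dist_real_def)
  qed
  thus ?thesis using \<open>c > 0\<close> \<eta>(1) unfolding r_def by blast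
qed

text \<open>
  The two regimes together. Near the origin the rate is not bounded away from \<open>0\<close>, which is why sets
  with \<open>u \<le> \<delta> v\<close> go to \<open>expected_traps_small\<close>. For \<open>u > \<delta> v\<close> the nearby point of \<open>T\<close> has abscissa at
  least \<open>\<delta> / 2\<close> once \<open>v > 2 / \<delta>\<close>, and these points of \<open>T\<close> form a compact set that avoids the origin.
\<close>
lemma expected_traps_le_inverse_square:
  assumes a: "a \<ge> 1" and "compact T" and T: "\<And>p. p \<in> T \<Longrightarrow> p \<noteq> (0, 0) \<Longrightarrow> subcritical a p"
  shows "\<exists>C v0. \<forall>v\<ge>v0. \<forall>u w x y. 0 < u \<longrightarrow> u \<le> w \<longrightarrow> w \<le> v \<longrightarrow> w \<le> a * u \<longrightarrow> (x, y) \<in> T \<longrightarrow>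
    \<bar>real u - real v * x\<bar> \<le> 1 \<longrightarrow> \<bar>real w - real v * y\<bar> \<le> 1 \<longrightarrow>
    expected_traps (a + 3) v u w \<le> C / (real v)\<^sup>2"
proof -
  obtain \<delta> where \<delta>: "\<delta> > 0" and small: "\<And>v u w. 0 < u \<Longrightarrow> u \<le> w \<Longrightarrow> w \<le> a * u \<Longrightarrow>
      real u \<le> \<delta> * real v \<Longrightarrow> expected_traps (a + 3) v u w \<le> 1 / \<delta>\<^sup>2 / (real v)\<^sup>2"
    using expected_traps_small[OF a] by blast
  define K where "K = T \<inter> {p. fst p \<ge> \<delta> / 2}"
  have "closed {p :: real \<times> real. fst p \<ge> \<delta> / 2}" by (intro closed_Collect_le continuous_intros)
  hence "compact K" unfolding K_def by (rule compact_Int_closed[OF \<open>compact T\<close>])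
  moreover have "subcritical a p" if "p \<in> K" for p
  proof (rule T)
    show "p \<in> T" "p \<noteq> (0, 0)" using that \<delta> by (auto simp: K_def)
  qed
  ultimately obtain c \<eta> where c: "c > 0" "\<eta> > 0" and near: "\<And>x y u w. (x, y) \<in> K \<Longrightarrow> 0 \<le> u \<Longrightarrow> u \<le> w \<Longrightarrow> w \<le> 1
      \<Longrightarrow> \<bar>u - x\<bar> + \<bar>w - y\<bar> < \<eta> \<Longrightarrow> rate (real a + 3) (u, w) \<le> - c"
    using rate_neg_near_compact[of K a] by metis
  have "((\<lambda>v. v\<^sup>2 * exp (v * - c + 2 * (real a + 2) * (ln (v + 1) + 1))) \<longlongrightarrow> 0) at_top"
    using c a by real_asymp
  hence "\<forall>\<^sub>F v in at_top. v\<^sup>2 * exp (v * - c + 2 * (real a + 2) * (ln (v + 1) + 1)) < 1"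
    by (rule order_tendstoD) simp
  hence "\<forall>\<^sub>F v in sequentially.
     (real v)\<^sup>2 * exp (real v * - c + 2 * (real a + 2) * (ln (real v + 1) + 1)) < 1"
    by (rule eventually_compose_filterlim[OF _ filterlim_real_sequentially])
  moreover have "\<forall>\<^sub>F v in sequentially. real v > max (2 / \<delta>) (2 / \<eta>)"
    using filterlim_at_top_dense[THEN iffD1, OF filterlim_real_sequentially] by blast
  ultimately have "\<forall>\<^sub>F v in sequentially. real v > max (2 / \<delta>) (2 / \<eta>) \<and>
     (real v)\<^sup>2 * exp (real v * - c + 2 * (real a + 2) * (ln (real v + 1) + 1)) < 1"
    by eventually_elim simp
  then obtain v0 where v0: "\<And>v. v \<ge> v0 \<Longrightarrow> real v > 2 / \<delta> \<and> real v > 2 / \<eta> \<and>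
     (real v)\<^sup>2 * exp (real v * - c + 2 * (real a + 2) * (ln (real v + 1) + 1)) < 1"
    unfolding eventually_sequentially by auto
  show ?thesis
  proof (intro exI[of _ "1 / \<delta>\<^sup>2 + 1"] exI[of _ v0] allI impI)
    fix v u w :: nat and x y :: real
    assume "v \<ge> v0" and u: "0 < u" "u \<le> w" "w \<le> v" "w \<le> a * u" and xy: "(x, y) \<in> T"
      "\<bar>real u - real v * x\<bar> \<le> 1" "\<bar>real w - real v * y\<bar> \<le> 1"
    note v0 = v0[OF \<open>v \<ge> v0\<close>]
    have v: "real v > 0" using u by simp
    show "expected_traps (a + 3) v u w \<le> (1 / \<delta>\<^sup>2 + 1) / (real v)\<^sup>2"
    proof (cases "real u \<le> \<delta> * real v")
      case True
      have "expected_traps (a + 3) v u w \<le> 1 / \<delta>\<^sup>2 / (real v)\<^sup>2" by (rule small[OF u(1,2,4) True])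
      also have "\<dots> \<le> (1 / \<delta>\<^sup>2 + 1) / (real v)\<^sup>2" by (intro divide_right_mono) auto
      finally show ?thesis .
    next
      case False
      have close: "\<bar>real u / real v - x\<bar> \<le> 1 / real v" "\<bar>real w / real v - y\<bar> \<le> 1 / real v"
        using xy(2,3) v by (simp_all add: abs_le_iff field_simps)
      have "1 / real v < \<delta> / 2" "1 / real v < \<eta> / 2"
        using v0 v \<delta> c by (auto simp: field_simps)
      moreover have "\<delta> < real u / real v" using False v by (simp add: field_simps)
      ultimately have "(x, y) \<in> K" "\<bar>real u / real v - x\<bar> + \<bar>real w / real v - y\<bar> < \<eta>"
        using close xy(1) unfolding K_def by auto
      hence "rate (real a + 3) (real u / real v, real w / real v) \<le> - c"
        using u v by (intro near) (auto simp: divide_right_mono)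
      hence "real v * rate (real a + 3) (real u / real v, real w / real v) \<le> real v * - c"
        using v by (intro mult_left_mono) auto
      hence "exp (real v * rate (real (a + 3)) (real u / real v, real w / real v)
         + 2 * (real (a + 3) - 1) * (ln (real v + 1) + 1))
        \<le> exp (real v * - c + 2 * (real a + 2) * (ln (real v + 1) + 1))"
        by (simp add: algebra_simps)
      hence "expected_traps (a + 3) v u w \<le> exp (real v * - c + 2 * (real a + 2) * (ln (real v + 1) + 1))"
        using expected_traps_le_rate[of "a + 3" u w v] u v by linarith
      also have "\<dots> \<le> 1 / (real v)\<^sup>2" using v0 v by (simp add: field_simps)
      also have "\<dots> \<le> (1 / \<delta>\<^sup>2 + 1) / (real v)\<^sup>2" by (intro divide_right_mono) auto
      finally show ?thesis .
    qed
  qed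
qed

section \<open>Permutations with the expansion property\<close>

text \<open>
  The graph of \<open>g\<close> may lie on \<open>T\<close> or on its mirror image; the duality of traps exchanges the two.
\<close>
lemma expanding_permutations:
  assumes a: "a \<ge> 1" and T: "compact T" "\<And>p. p \<in> T \<Longrightarrow> p \<noteq> (0, 0) \<Longrightarrow> subcritical a p"
    and g: "\<And>t. 0 < t \<Longrightarrow> t < 1 \<Longrightarrow> (t, g t) \<in> T \<or> (1 - g t, 1 - t) \<in> T"
  shows "\<exists>v0. \<forall>v\<ge>v0. \<exists>p. (\<forall>i<a + 3. p i permutes {..<v}) \<and>
    (\<forall>U \<subseteq> {..<v}. U \<noteq> {} \<longrightarrow> U \<noteq> {..<v} \<longrightarrow>
      real v * g (real (card U) / real v) \<le> real (card (\<Union>i<a + 3. p i ` U)) \<and>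
      real v * g (real (card U) / real v) \<le> real (card (\<Union>i<a + 3. p i -` U)))"
proof -
  obtain C v1 where E: "\<And>v u w x y. v \<ge> v1 \<Longrightarrow> 0 < u \<Longrightarrow> u \<le> w \<Longrightarrow> w \<le> v \<Longrightarrow> w \<le> a * u \<Longrightarrow> (x, y) \<in> T
      \<Longrightarrow> \<bar>real u - real v * x\<bar> \<le> 1 \<Longrightarrow> \<bar>real w - real v * y\<bar> \<le> 1
      \<Longrightarrow> expected_traps (a + 3) v u w \<le> C / (real v)\<^sup>2"
    using expected_traps_le_inverse_square[OF a T] by metis
  obtain v2 where v2: "real v2 > 2 * \<bar>C\<bar>" using reals_Archimedean2 by blast
  show ?thesis
  proof (intro exI[of _ "max v1 (max v2 1)"] allI impI)
    fix v assume "v \<ge> max v1 (max v2 1)"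
    hence v: "v \<ge> v1" "v > 0" "real v > 2 * \<bar>C\<bar>" using v2 by auto
    \<comment> \<open>the largest integer strictly below the required number of neighbours\<close>
    define wt where "wt u = nat (\<lceil>real v * g (real u / real v)\<rceil> - 1)" for u
    have wt: "u \<le> wt u" "wt u < v" "real (wt u) < real v * g (real u / real v)"
      "real v * g (real u / real v) \<le> real (wt u) + 1"
      and le: "expected_traps (a + 3) v u (wt u) \<le> C / (real v)\<^sup>2"
      if "0 < u" "u < v" for u
    proof -
      define x where "x = real u / real v"
      have x: "0 < x" "x < 1" "real v * x = real u" using that by (auto simp: x_def)
      \<comment> \<open>the slope bound is available at \<open>(x, g x)\<close> itself or at its mirror image, together with membership\<close>
      have "x < g x \<and> g x < 1 \<and> ((x, g x) \<in> T \<and> g x \<le> real a * x \<or>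
         (1 - g x, 1 - x) \<in> T \<and> 1 - x \<le> real a * (1 - g x))"
        using g[OF x(1,2)]
      proof
        assume *: "(x, g x) \<in> T"
        thus ?thesis using T(2)[OF *] x by (auto simp: subcritical_def)
      next
        assume *: "(1 - g x, 1 - x) \<in> T"
        thus ?thesis using T(2)[OF *] x by (auto simp: subcritical_def)
      qed
      hence gx: "x < g x" "g x < 1" and cases: "(x, g x) \<in> T \<and> g x \<le> real a * x \<or>
         (1 - g x, 1 - x) \<in> T \<and> 1 - x \<le> real a * (1 - g x)" by blast+
      have "real v * x < real v * g x" "real v * g x < real v * 1"
        using v gx by (simp_all only: mult_strict_left_mono of_nat_0_less_iff)
      hence vg: "real u < real v * g x" "real v * g x < real v" using x by simp_all
      have ceil: "int u < \<lceil>real v * g x\<rceil>" "\<lceil>real v * g x\<rceil> \<le> int v"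
        using vg gx by (simp_all add: less_ceiling_iff ceiling_le_iff)
      have "0 \<le> \<lceil>real v * g x\<rceil> - 1" using ceil by linarith
      hence int_wt: "int (wt u) = \<lceil>real v * g x\<rceil> - 1"
        unfolding wt_def x_def by (rule nat_0_le)
      have "real (wt u) = real_of_int (int (wt u))" by simp
      hence real_wt: "real (wt u) = real_of_int \<lceil>real v * g x\<rceil> - 1" unfolding int_wt by simp
      show wt1: "u \<le> wt u" and wt2: "wt u < v" using ceil int_wt by linarith+
      have wt3: "real (wt u) < real v * g x" and wt4: "real v * g x \<le> real (wt u) + 1"
        unfolding real_wt by linarith+
      thus "real (wt u) < real v * g (real u / real v)"
        "real v * g (real u / real v) \<le> real (wt u) + 1" by (simp_all add: x_def)
      show "expected_traps (a + 3) v u (wt u) \<le> C / (real v)\<^sup>2"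
        using cases
      proof
        assume *: "(x, g x) \<in> T \<and> g x \<le> real a * x"
        have "real v * g x \<le> real v * (real a * x)" using * by (intro mult_left_mono) auto
        also have "\<dots> = real (a * u)" using x by (simp add: mult.left_commute)
        finally have "wt u \<le> a * u" using wt3 by linarith
        moreover have "\<bar>real u - real v * x\<bar> \<le> 1" using x by simp
        moreover have "\<bar>real (wt u) - real v * g x\<bar> \<le> 1" using wt3 wt4 by linarith
        ultimately show ?thesis
          using E[OF v(1) that(1) wt1 less_imp_le[OF wt2] _ conjunct1[OF *]] by blast
      next
        assume *: "(1 - g x, 1 - x) \<in> T \<and> 1 - x \<le> real a * (1 - g x)"
        have "real v * (1 - x) \<le> real v * (real a * (1 - g x))" using * by (intro mult_left_mono) auto
        hence "real v - real u \<le> real a * (real v - real v * g x)"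
          using x by (simp add: algebra_simps)
        also have "\<dots> \<le> real a * real (v - wt u)"
          using wt2 wt3 by (intro mult_left_mono) (auto simp: of_nat_diff)
        finally have "real (v - u) \<le> real (a * (v - wt u))" using that wt2 by (simp add: of_nat_diff)
        hence "v - u \<le> a * (v - wt u)" by (simp only: of_nat_le_iff)
        moreover have "real (v - wt u) = real v - real (wt u)" "real (v - u) = real v - real u"
          using wt2 that by simp_all
        hence "\<bar>real (v - wt u) - real v * (1 - g x)\<bar> \<le> 1" "\<bar>real (v - u) - real v * (1 - x)\<bar> \<le> 1"
          unfolding right_diff_distrib using wt3 wt4 x(3) by linarith+
        moreover have "0 < v - wt u" "v - wt u \<le> v - u" "v - u \<le> v" using wt1 wt2 by linarith+
        ultimately have "expected_traps (a + 3) v (v - wt u) (v - u) \<le> C / (real v)\<^sup>2"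
          using E[OF v(1) _ _ _ _ conjunct1[OF *]] by blast
        thus ?thesis using expected_traps_dual[OF wt1] wt2 by simp
      qed
    qed
    \<comment> \<open>the first pairs concern sets on the left, their duals concern sets on the right\<close>
    define B where "B = (\<lambda>u. (u, wt u)) ` {0<..<v} \<union> (\<lambda>u. (v - wt u, v - u)) ` {0<..<v}"
    have "(\<Sum>(u, w)\<in>B. expected_traps (a + 3) v u w) \<le> (\<Sum>b\<in>B. C / (real v)\<^sup>2)"
    proof (rule sum_mono)
      fix b assume "b \<in> B"
      then obtain u where "0 < u" "u < v" "b = (u, wt u) \<or> b = (v - wt u, v - u)"
        by (auto simp: B_def)
      thus "(case b of (u, w) \<Rightarrow> expected_traps (a + 3) v u w) \<le> C / (real v)\<^sup>2"
        using le[of u] expected_traps_dual[OF wt(1), of u v] wt(2)[of u] by auto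
    qed
    also have "\<dots> \<le> 2 * real v * (\<bar>C\<bar> / (real v)\<^sup>2)"
    proof -
      have "card B \<le> card {0<..<v} + card {0<..<v}"
        unfolding B_def by (intro order.trans[OF card_Un_le] add_mono card_image_le) auto
      hence "real (card B) \<le> 2 * real v" by simp
      hence "real (card B) * (\<bar>C\<bar> / (real v)\<^sup>2) \<le> 2 * real v * (\<bar>C\<bar> / (real v)\<^sup>2)"
        by (rule mult_right_mono) simp
      moreover have "real (card B) * (C / (real v)\<^sup>2) \<le> real (card B) * (\<bar>C\<bar> / (real v)\<^sup>2)"
        by (intro mult_left_mono divide_right_mono) auto
      ultimately show ?thesis by simp
    qed
    also have "\<dots> < 1" using v by (simp add: power2_eq_square)
    finally have "(\<Sum>(u, w)\<in>B. expected_traps (a + 3) v u w) < 1" .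
    moreover have "finite B" "\<And>u w. (u, w) \<in> B \<Longrightarrow> u \<le> v" by (auto simp: B_def)
    ultimately obtain p where perm: "\<And>i. i < a + 3 \<Longrightarrow> p i permutes {..<v}"
      and avoid: "\<And>U X. U \<subseteq> {..<v} \<Longrightarrow> X \<subseteq> {..<v} \<Longrightarrow> (card U, card X) \<in> B \<Longrightarrow> \<exists>i<a + 3. \<not> p i ` U \<subseteq> X"
      using ex_permutations_without_traps[of B v "a + 3"] by metis
    have enlarge: "\<exists>X. N \<subseteq> X \<and> X \<subseteq> {..<v} \<and> card X = wt u"
      if "N \<subseteq> {..<v}" "real (card N) < real v * g (real u / real v)" "0 < u" "u < v" for N u
    proof -
      have "card N \<le> wt u" using that(2) wt(4)[OF that(3,4)] by linarith
      moreover have "wt u \<le> card {..<v}" using wt(2)[OF that(3,4)] by simp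
      ultimately show ?thesis using exists_subset_between[of N "wt u" "{..<v}"] that(1) by auto
    qed
    have "real v * g (real (card U) / real v) \<le> real (card (\<Union>i<a + 3. p i ` U)) \<and>
      real v * g (real (card U) / real v) \<le> real (card (\<Union>i<a + 3. p i -` U))"
      if U: "U \<subseteq> {..<v}" "U \<noteq> {}" "U \<noteq> {..<v}" for U
    proof -
      have fU: "finite U" using U(1) finite_subset by auto
      have u: "0 < card U" "card U < v"
        using U fU psubset_card_mono[of "{..<v}" U] by (auto simp: card_gt_0_iff)
      have inB: "(card U, wt (card U)) \<in> B" "(v - wt (card U), v - card U) \<in> B"
        using u by (auto simp: B_def)
      have im: "p i x < v \<longleftrightarrow> x < v" if "i < a + 3" for i x
        using permutes_in_image[OF perm[OF that]] by auto
      show ?thesis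
      proof (intro conjI; rule ccontr)
        assume "\<not> real v * g (real (card U) / real v) \<le> real (card (\<Union>i<a + 3. p i ` U))"
        moreover have "(\<Union>i<a + 3. p i ` U) \<subseteq> {..<v}" using U(1) im by auto
        ultimately obtain X where X: "(\<Union>i<a + 3. p i ` U) \<subseteq> X" "X \<subseteq> {..<v}" "card X = wt (card U)"
          using enlarge u by (meson not_le)
        thus False using avoid[OF U(1) X(2)] inB(1) by auto
      next
        assume "\<not> real v * g (real (card U) / real v) \<le> real (card (\<Union>i<a + 3. p i -` U))"
        moreover have "(\<Union>i<a + 3. p i -` U) \<subseteq> {..<v}" using U(1) im by auto
        ultimately obtain Y where Y: "(\<Union>i<a + 3. p i -` U) \<subseteq> Y" "Y \<subseteq> {..<v}" "card Y = wt (card U)"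
          using enlarge u by (meson not_le)
        \<comment> \<open>a set on the right with too few neighbours yields a trap for the complement of these neighbours\<close>
        have "card ({..<v} - Y) = v - wt (card U)" "card ({..<v} - U) = v - card U"
          using Y U(1) fU finite_subset[OF Y(2)] by (simp_all add: card_Diff_subset)
        hence "\<exists>i<a + 3. \<not> p i ` ({..<v} - Y) \<subseteq> {..<v} - U"
          using inB(2) by (intro avoid) auto
        then obtain i x where "i < a + 3" "x < v" "x \<notin> Y" "\<not> (p i x < v \<and> p i x \<notin> U)" by auto
        thus False using Y(1) im by auto
      qed
    qed
    thus "\<exists>p. (\<forall>i<a + 3. p i permutes {..<v}) \<and>
      (\<forall>U \<subseteq> {..<v}. U \<noteq> {} \<longrightarrow> U \<noteq> {..<v} \<longrightarrow>
        real v * g (real (card U) / real v) \<le> real (card (\<Union>i<a + 3. p i ` U)) \<and>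
        real v * g (real (card U) / real v) \<le> real (card (\<Union>i<a + 3. p i -` U)))"
      using perm by (intro exI[of _ p]) simp
  qed
qed

section \<open>The multigraph of a family of permutations\<close>

definition union_of_matchings :: "nat \<Rightarrow> nat \<Rightarrow> (nat \<Rightarrow> nat \<Rightarrow> nat) \<Rightarrow> nat multigraph" where
  "union_of_matchings d v p = \<lparr>nodes = {..<2 * v},
     edges = (\<Sum>i<d. image_mset (\<lambda>x. {x, v + p i x}) (mset_set {..<v}))\<rparr>"

lemma edge_union_of_matchings:
  "e \<in># edges (union_of_matchings d v p) \<longleftrightarrow> (\<exists>i<d. \<exists>x<v. e = {x, v + p i x})"
proof -
  have "e \<in># (\<Sum>i<d. M i) \<longleftrightarrow> (\<exists>i<d. e \<in># M i)" for M :: "nat \<Rightarrow> nat set multiset"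
    by (induction d) (auto simp: less_Suc_eq)
  thus ?thesis by (auto simp: union_of_matchings_def)
qed

context
  fixes d v :: nat and p :: "nat \<Rightarrow> nat \<Rightarrow> nat"
  assumes perm: "\<And>i. i < d \<Longrightarrow> p i permutes {..<v}"
begin

lemma permutation_less_iff: "i < d \<Longrightarrow> p i x < v \<longleftrightarrow> x < v"
  using permutes_in_image[OF perm] by auto

lemma multigraph_union_of_matchings: "multigraph (union_of_matchings d v p)"
  unfolding multigraph_def
proof (intro conjI ballI)
  fix e assume "e \<in># edges (union_of_matchings d v p)"
  then obtain i x where "i < d" "x < v" "e = {x, v + p i x}"
    by (auto simp: edge_union_of_matchings)
  thus "e \<subseteq> nodes (union_of_matchings d v p)" "card e = 2"
    using permutation_less_iff[of i x] by (auto simp: union_of_matchings_def)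
qed (simp add: union_of_matchings_def)

lemma bipartite_union_of_matchings: "bipartite (union_of_matchings d v p) {..<v} {v..<2 * v}"
  unfolding bipartite_def
proof (intro conjI ballI)
  fix e assume "e \<in># edges (union_of_matchings d v p)"
  then obtain i x where "i < d" "x < v" "e = {x, v + p i x}"
    by (auto simp: edge_union_of_matchings)
  thus "\<exists>x\<in>{..<v}. \<exists>y\<in>{v..<2 * v}. e = {x, y}"
    using permutation_less_iff[of i x] by (intro bexI[of _ x] bexI[of _ "v + p i x"]) auto
qed (auto simp: union_of_matchings_def)

lemma regular_union_of_matchings: "regular (union_of_matchings d v p) d"
  unfolding regular_def
proof
  fix x assume "x \<in> nodes (union_of_matchings d v p)"
  hence x: "x < 2 * v" by (simp add: union_of_matchings_def)
  have one: "card {y. y < v \<and> (x = y \<or> x = v + p i y)} = 1" if i: "i < d" for i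
  proof (cases "x < v")
    case True
    hence "{y. y < v \<and> (x = y \<or> x = v + p i y)} = {x}" by auto
    thus ?thesis by simp
  next
    case False
    define z where "z = inv (p i) (x - v)"
    have z: "p i z = x - v" using permutes_inverses(1)[OF perm[OF i]] by (simp add: z_def)
    hence "p i z < v" using x False by linarith
    have "z < v" using permutation_less_iff[OF i, of z] \<open>p i z < v\<close> by blast
    have "y = z" if "y < v" "x = y \<or> x = v + p i y" for y
    proof (rule injD[OF permutes_inj[OF perm[OF i]]])
      show "p i y = p i z" using that z False by auto
    qed
    moreover have "x = v + p i z" using z False by simp
    ultimately have "{y. y < v \<and> (x = y \<or> x = v + p i y)} = {z}"
      using \<open>z < v\<close> by blast
    thus ?thesis by simp
  qed
  have "size (filter_mset P (\<Sum>i<d. M i)) = (\<Sum>i<d. size (filter_mset P (M i)))"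
    for P and M :: "nat \<Rightarrow> nat set multiset"
    by (induction d) auto
  hence "Defs.degree (union_of_matchings d v p) x =
      (\<Sum>i<d. size (filter_mset (\<lambda>e. x \<in> e) (image_mset (\<lambda>x. {x, v + p i x}) (mset_set {..<v}))))"
    by (simp add: Defs.degree_def union_of_matchings_def)
  also have "\<dots> = (\<Sum>i<d. card {y. y < v \<and> (x = y \<or> x = v + p i y)})"
    by (simp add: filter_mset_image_mset filter_mset_mset_set)
  also have "\<dots> = d" using one by simp
  finally show "Defs.degree (union_of_matchings d v p) x = d" .
qed

lemma card_neighbours_left:
  assumes "U \<subseteq> {..<v}"
  shows "card (neighbours (union_of_matchings d v p) U) = card (\<Union>i<d. p i ` U)"
proof -
  have "y \<in> neighbours (union_of_matchings d v p) U \<longleftrightarrow> y \<in> (+) v ` (\<Union>i<d. p i ` U)" for y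
  proof
    assume "y \<in> neighbours (union_of_matchings d v p) U"
    then obtain x i z where "x \<in> U" "i < d" "z < v" "{x, y} = {z, v + p i z}"
      by (auto simp: neighbours_def edge_union_of_matchings)
    moreover from this have "x < v" using assms by auto
    ultimately have "y = v + p i x" by (auto simp: doubleton_eq_iff)
    thus "y \<in> (+) v ` (\<Union>i<d. p i ` U)" using \<open>x \<in> U\<close> \<open>i < d\<close> by blast
  next
    assume "y \<in> (+) v ` (\<Union>i<d. p i ` U)"
    then obtain x i where xi: "x \<in> U" "i < d" "y = v + p i x" by blast
    moreover have "x < v" using xi(1) assms by auto
    ultimately have "{x, y} \<in># edges (union_of_matchings d v p)"
      unfolding edge_union_of_matchings by blast
    moreover have "y < 2 * v" using permutation_less_iff[OF xi(2)] xi(3) \<open>x < v\<close> by simp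
    ultimately show "y \<in> neighbours (union_of_matchings d v p) U"
      using xi(1) by (auto simp: neighbours_def union_of_matchings_def)
  qed
  hence "neighbours (union_of_matchings d v p) U = (+) v ` (\<Union>i<d. p i ` U)" by blast
  thus ?thesis by (simp add: card_image)
qed

lemma card_neighbours_right:
  assumes "U \<subseteq> {..<v}"
  shows "card (neighbours (union_of_matchings d v p) ((+) v ` U)) = card (\<Union>i<d. p i -` U)"
proof -
  have "y \<in> neighbours (union_of_matchings d v p) ((+) v ` U) \<longleftrightarrow> y \<in> (\<Union>i<d. p i -` U)" for y
  proof
    assume "y \<in> neighbours (union_of_matchings d v p) ((+) v ` U)"
    then obtain x i z where "x \<in> U" "i < d" "z < v" "{v + x, y} = {z, v + p i z}"
      by (auto simp: neighbours_def edge_union_of_matchings)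
    moreover from this have "y = z" "p i z = x" by (auto simp: doubleton_eq_iff)
    ultimately show "y \<in> (\<Union>i<d. p i -` U)" by auto
  next
    assume "y \<in> (\<Union>i<d. p i -` U)"
    then obtain i where i: "i < d" "p i y \<in> U" by blast
    hence "y < v" using assms permutation_less_iff[OF i(1), of y] by auto
    hence "{v + p i y, y} \<in># edges (union_of_matchings d v p)"
      unfolding edge_union_of_matchings using i(1) by (auto simp: insert_commute)
    thus "y \<in> neighbours (union_of_matchings d v p) ((+) v ` U)"
      using i(2) \<open>y < v\<close> by (auto simp: neighbours_def union_of_matchings_def)
  qed
  hence "neighbours (union_of_matchings d v p) ((+) v ` U) = (\<Union>i<d. p i -` U)" by blast
  thus ?thesis by simp
qed

end

text \<open>
  The values at \<open>0\<close> and \<open>1\<close> settle the empty set and a full side, which have \<open>0\<close> and \<open>v\<close> neighbours.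
\<close>
lemma expanding_multigraph:
  assumes a: "a \<ge> 1" and T: "compact T" "\<And>p. p \<in> T \<Longrightarrow> p \<noteq> (0, 0) \<Longrightarrow> subcritical a p"
    and curve: "\<And>t. 0 < t \<Longrightarrow> t < 1 \<Longrightarrow> (t, F 1 t) \<in> T \<or> (1 - F 1 t, 1 - t) \<in> T"
    and ends: "F 1 0 = 0" "F 1 1 = 1"
    and scale: "\<And>v u. v > 0 \<Longrightarrow> F v u = v * F 1 (u / v)"
  shows "\<exists>v0. \<forall>v\<ge>v0. v > 0 \<longrightarrow> (\<exists>(G :: nat multigraph) V W.
        multigraph G \<and> bipartite G V W \<and> regular G (a + 3) \<and>
        card (nodes G) = 2 * v \<and> card V = v \<and> card W = v \<and>
        (\<forall>U. U \<subseteq> V \<or> U \<subseteq> W \<longrightarrow>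
           real (card (neighbours G U)) \<ge> F (real v) (real (card U))))"
proof -
  obtain v0 where v0: "\<And>v. v \<ge> v0 \<Longrightarrow> \<exists>p. (\<forall>i<a + 3. p i permutes {..<v}) \<and>
    (\<forall>U \<subseteq> {..<v}. U \<noteq> {} \<longrightarrow> U \<noteq> {..<v} \<longrightarrow>
      real v * F 1 (real (card U) / real v) \<le> real (card (\<Union>i<a + 3. p i ` U)) \<and>
      real v * F 1 (real (card U) / real v) \<le> real (card (\<Union>i<a + 3. p i -` U)))"
    using expanding_permutations[OF a T curve] by blast
  show ?thesis
  proof (intro exI[of _ v0] allI impI)
    fix v assume "v \<ge> v0" "v > 0"
    obtain p where perm: "\<And>i. i < a + 3 \<Longrightarrow> p i permutes {..<v}"
      and inner: "\<And>U. U \<subseteq> {..<v} \<Longrightarrow> U \<noteq> {} \<Longrightarrow> U \<noteq> {..<v} \<Longrightarrow>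
        real v * F 1 (real (card U) / real v) \<le> real (card (\<Union>i<a + 3. p i ` U)) \<and>
        real v * F 1 (real (card U) / real v) \<le> real (card (\<Union>i<a + 3. p i -` U))"
      using v0[OF \<open>v \<ge> v0\<close>] by blast
    have all: "real v * F 1 (real (card U) / real v) \<le> real (card (\<Union>i<a + 3. p i ` U)) \<and>
        real v * F 1 (real (card U) / real v) \<le> real (card (\<Union>i<a + 3. p i -` U))"
      if "U \<subseteq> {..<v}" for U
    proof -
      have "(\<Union>i<a + 3. p i ` {..<v}) = (\<Union>i<a + 3. {..<v})"
        "(\<Union>i<a + 3. p i -` {..<v}) = (\<Union>i<a + 3. {..<v})"
        using permutes_image[OF perm] permutes_vimage[OF perm] by simp_all
      hence "(\<Union>i<a + 3. p i ` {..<v}) = {..<v}" "(\<Union>i<a + 3. p i -` {..<v}) = {..<v}"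
        by (simp_all add: lessThan_empty_iff)
      thus ?thesis using inner[OF that] ends \<open>v > 0\<close> by (cases "U = {} \<or> U = {..<v}") auto
    qed
    let ?G = "union_of_matchings (a + 3) v p"
    have "real v * F 1 (real (card U) / real v) \<le> real (card (neighbours ?G U))"
      if U: "U \<subseteq> {..<v} \<or> U \<subseteq> {v..<2 * v}" for U
    proof (cases "U \<subseteq> {..<v}")
      case True
      thus ?thesis using all[OF True] card_neighbours_left[OF perm True] by simp
    next
      case False
      define U' where "U' = (\<lambda>x. x - v) ` U"
      have right: "U \<subseteq> {v..<2 * v}" using U False by blast
      have "x - v < v" if "x \<in> U" for x using subsetD[OF right that] by simp linarith
      hence sub: "U' \<subseteq> {..<v}" by (auto simp: U'_def)
      have "(+) v ` U' = (\<lambda>x. x) ` U"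
        unfolding U'_def image_image by (rule image_cong) (use right in auto)
      hence U_eq: "U = (+) v ` U'" by simp
      have "card U = card U'" unfolding U_eq by (simp add: card_image)
      moreover have "card (neighbours ?G U) = card (\<Union>i<a + 3. p i -` U')"
        unfolding U_eq by (rule card_neighbours_right[OF perm sub])
      ultimately show ?thesis using all[OF sub] by simp
    qed
    thus "\<exists>(G :: nat multigraph) V W.
        multigraph G \<and> bipartite G V W \<and> regular G (a + 3) \<and>
        card (nodes G) = 2 * v \<and> card V = v \<and> card W = v \<and>
        (\<forall>U. U \<subseteq> V \<or> U \<subseteq> W \<longrightarrow>
           real (card (neighbours G U)) \<ge> F (real v) (real (card U)))"
    proof (intro exI conjI)
      show "multigraph ?G" by (rule multigraph_union_of_matchings[OF perm])
      show "bipartite ?G {..<v} {v..<2 * v}" by (rule bipartite_union_of_matchings[OF perm])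
      show "regular ?G (a + 3)" by (rule regular_union_of_matchings[OF perm])
      show "card (nodes ?G) = 2 * v" by (simp add: union_of_matchings_def)
    qed (use scale[of "real v"] \<open>v > 0\<close> in simp_all)
  qed
qed

section \<open>The four piecewise linear functions\<close>

lemma in_segment:
  fixes x y x0 y0 x1 y1 :: real
  assumes "x0 \<le> x" "x \<le> x1" "x0 < x1" "(x1 - x0) * (y - y0) = (x - x0) * (y1 - y0)"
  shows "(x, y) \<in> closed_segment (x0, y0) (x1, y1)"
proof -
  define t where "t = (x - x0) / (x1 - x0)"
  have "0 \<le> t" "t \<le> 1" using assms by (auto simp: t_def)
  moreover have "t * (x1 - x0) = x - x0" using assms(3) by (simp add: t_def)
  moreover have "t * (y1 - y0) = y - y0" using assms(3,4) by (simp add: t_def field_simps)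
  ultimately show ?thesis unfolding closed_segment_def
    by (auto simp: algebra_simps intro!: exI[of _ t])
qed

text \<open>
  Each lower curve is the part of the graph of the respective function at \<open>v = 1\<close> that runs from the
  origin to the first breakpoint on or beyond the mirror line \<open>x + y = 1\<close>.
\<close>
definition lower_curve5 :: "(real \<times> real) set" where
  "lower_curve5 = closed_segment (0, 0) (3/20, 3/10)
    \<union> closed_segment (3/20, 3/10) (3/10, 1/2)
    \<union> closed_segment (3/10, 1/2) (1/2, 7/10)"

lemma compact_lower_curve5: "compact lower_curve5"
  unfolding lower_curve5_def by (intro compact_Un compact_segment)

text \<open>
  The pieces of each function after its lower curve are the mirror images of the first pieces in
  reverse order, which is why the segments occur in the cases in that order.
\<close>
lemma f5_on_lower_curve_or_mirror:
  assumes "0 < t" "t < 1"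
  shows "(t, f5 1 t) \<in> lower_curve5 \<or> (1 - f5 1 t, 1 - t) \<in> lower_curve5"
proof -
  consider "t \<le> 3/20" | "3/20 < t" "t \<le> 3/10" | "3/10 < t" "t \<le> 1/2" | "1/2 < t" "t \<le> 7/10" | "7/10 < t"
    by linarith
  thus ?thesis
  proof cases
    case 1
    have "(t, f5 1 t) \<in> closed_segment (0, 0) (3/20, 3/10)"
      by (rule in_segment) (use 1 assms in \<open>simp_all add: f5_def\<close>)
    thus ?thesis by (simp add: lower_curve5_def)
  next
    case 2
    have "(t, f5 1 t) \<in> closed_segment (3/20, 3/10) (3/10, 1/2)"
      by (rule in_segment) (use 2 assms in \<open>simp_all add: f5_def\<close>)
    thus ?thesis by (simp add: lower_curve5_def)
  next
    case 3
    have "(t, f5 1 t) \<in> closed_segment (3/10, 1/2) (1/2, 7/10)"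
      by (rule in_segment) (use 3 assms in \<open>simp_all add: f5_def\<close>)
    thus ?thesis by (simp add: lower_curve5_def)
  next
    case 4
    have "(1 - f5 1 t, 1 - t) \<in> closed_segment (3/20, 3/10) (3/10, 1/2)"
      by (rule in_segment) (use 4 assms in \<open>simp_all add: f5_def\<close>)
    thus ?thesis by (simp add: lower_curve5_def)
  next
    case 5
    have "(1 - f5 1 t, 1 - t) \<in> closed_segment (0, 0) (3/20, 3/10)"
      by (rule in_segment) (use 5 assms in \<open>simp_all add: f5_def\<close>)
    thus ?thesis by (simp add: lower_curve5_def)
  qed
qed

definition lower_curve6 :: "(real \<times> real) set" where
  "lower_curve6 = closed_segment (0, 0) (1/10, 1/4)
    \<union> closed_segment (1/10, 1/4) (1/4, 1/2)
    \<union> closed_segment (1/4, 1/2) (1/2, 3/4)"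

lemma compact_lower_curve6: "compact lower_curve6"
  unfolding lower_curve6_def by (intro compact_Un compact_segment)

lemma f6_on_lower_curve_or_mirror:
  assumes "0 < t" "t < 1"
  shows "(t, f6 1 t) \<in> lower_curve6 \<or> (1 - f6 1 t, 1 - t) \<in> lower_curve6"
proof -
  consider "t \<le> 1/10" | "1/10 < t" "t \<le> 1/4" | "1/4 < t" "t \<le> 1/2" | "1/2 < t" "t \<le> 3/4" | "3/4 < t"
    by linarith
  thus ?thesis
  proof cases
    case 1
    have "(t, f6 1 t) \<in> closed_segment (0, 0) (1/10, 1/4)"
      by (rule in_segment) (use 1 assms in \<open>simp_all add: f6_def\<close>)
    thus ?thesis by (simp add: lower_curve6_def)
  next
    case 2
    have "(t, f6 1 t) \<in> closed_segment (1/10, 1/4) (1/4, 1/2)"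
      by (rule in_segment) (use 2 assms in \<open>simp_all add: f6_def\<close>)
    thus ?thesis by (simp add: lower_curve6_def)
  next
    case 3
    have "(t, f6 1 t) \<in> closed_segment (1/4, 1/2) (1/2, 3/4)"
      by (rule in_segment) (use 3 assms in \<open>simp_all add: f6_def\<close>)
    thus ?thesis by (simp add: lower_curve6_def)
  next
    case 4
    have "(1 - f6 1 t, 1 - t) \<in> closed_segment (1/10, 1/4) (1/4, 1/2)"
      by (rule in_segment) (use 4 assms in \<open>simp_all add: f6_def\<close>)
    thus ?thesis by (simp add: lower_curve6_def)
  next
    case 5
    have "(1 - f6 1 t, 1 - t) \<in> closed_segment (0, 0) (1/10, 1/4)"
      by (rule in_segment) (use 5 assms in \<open>simp_all add: f6_def\<close>)
    thus ?thesis by (simp add: lower_curve6_def)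
  qed
qed

definition lower_curve7 :: "(real \<times> real) set" where
  "lower_curve7 = closed_segment (0, 0) (1/10, 3/10)
    \<union> closed_segment (1/10, 3/10) (3/20, 2/5)
    \<union> closed_segment (3/20, 2/5) (3/10, 61/100)
    \<union> closed_segment (3/10, 61/100) (39/100, 7/10)"

lemma compact_lower_curve7: "compact lower_curve7"
  unfolding lower_curve7_def by (intro compact_Un compact_segment)

lemma f7_on_lower_curve_or_mirror:
  assumes "0 < t" "t < 1"
  shows "(t, f7 1 t) \<in> lower_curve7 \<or> (1 - f7 1 t, 1 - t) \<in> lower_curve7"
proof -
  consider "t \<le> 1/10" | "1/10 < t" "t \<le> 3/20" | "3/20 < t" "t \<le> 3/10" | "3/10 < t" "t \<le> 39/100" | "39/100 < t" "t \<le> 3/5" | "3/5 < t" "t \<le> 7/10" | "7/10 < t"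
    by linarith
  thus ?thesis
  proof cases
    case 1
    have "(t, f7 1 t) \<in> closed_segment (0, 0) (1/10, 3/10)"
      by (rule in_segment) (use 1 assms in \<open>simp_all add: f7_def\<close>)
    thus ?thesis by (simp add: lower_curve7_def)
  next
    case 2
    have "(t, f7 1 t) \<in> closed_segment (1/10, 3/10) (3/20, 2/5)"
      by (rule in_segment) (use 2 assms in \<open>simp_all add: f7_def\<close>)
    thus ?thesis by (simp add: lower_curve7_def)
  next
    case 3
    have "(t, f7 1 t) \<in> closed_segment (3/20, 2/5) (3/10, 61/100)"
      by (rule in_segment) (use 3 assms in \<open>simp_all add: f7_def\<close>)
    thus ?thesis by (simp add: lower_curve7_def)
  next
    case 4
    have "(t, f7 1 t) \<in> closed_segment (3/10, 61/100) (39/100, 7/10)"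
      by (rule in_segment) (use 4 assms in \<open>simp_all add: f7_def\<close>)
    thus ?thesis by (simp add: lower_curve7_def)
  next
    case 5
    have "(1 - f7 1 t, 1 - t) \<in> closed_segment (3/20, 2/5) (3/10, 61/100)"
      by (rule in_segment) (use 5 assms in \<open>simp_all add: f7_def\<close>)
    thus ?thesis by (simp add: lower_curve7_def)
  next
    case 6
    have "(1 - f7 1 t, 1 - t) \<in> closed_segment (1/10, 3/10) (3/20, 2/5)"
      by (rule in_segment) (use 6 assms in \<open>simp_all add: f7_def\<close>)
    thus ?thesis by (simp add: lower_curve7_def)
  next
    case 7
    have "(1 - f7 1 t, 1 - t) \<in> closed_segment (0, 0) (1/10, 3/10)"
      by (rule in_segment) (use 7 assms in \<open>simp_all add: f7_def\<close>)
    thus ?thesis by (simp add: lower_curve7_def)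
  qed
qed

definition lower_curve8 :: "(real \<times> real) set" where
  "lower_curve8 = closed_segment (0, 0) (1/10, 3/10)
    \<union> closed_segment (1/10, 3/10) (1/5, 1/2)
    \<union> closed_segment (1/5, 1/2) (1/3, 2/3)"

lemma compact_lower_curve8: "compact lower_curve8"
  unfolding lower_curve8_def by (intro compact_Un compact_segment)

lemma f8_on_lower_curve_or_mirror:
  assumes "0 < t" "t < 1"
  shows "(t, f8 1 t) \<in> lower_curve8 \<or> (1 - f8 1 t, 1 - t) \<in> lower_curve8"
proof -
  consider "t \<le> 1/10" | "1/10 < t" "t \<le> 1/5" | "1/5 < t" "t \<le> 1/3" | "1/3 < t" "t \<le> 1/2" | "1/2 < t" "t \<le> 7/10" | "7/10 < t"
    by linarith
  thus ?thesis
  proof cases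
    case 1
    have "(t, f8 1 t) \<in> closed_segment (0, 0) (1/10, 3/10)"
      by (rule in_segment) (use 1 assms in \<open>simp_all add: f8_def\<close>)
    thus ?thesis by (simp add: lower_curve8_def)
  next
    case 2
    have "(t, f8 1 t) \<in> closed_segment (1/10, 3/10) (1/5, 1/2)"
      by (rule in_segment) (use 2 assms in \<open>simp_all add: f8_def\<close>)
    thus ?thesis by (simp add: lower_curve8_def)
  next
    case 3
    have "(t, f8 1 t) \<in> closed_segment (1/5, 1/2) (1/3, 2/3)"
      by (rule in_segment) (use 3 assms in \<open>simp_all add: f8_def\<close>)
    thus ?thesis by (simp add: lower_curve8_def)
  next
    case 4
    have "(1 - f8 1 t, 1 - t) \<in> closed_segment (1/5, 1/2) (1/3, 2/3)"
      by (rule in_segment) (use 4 assms in \<open>simp_all add: f8_def\<close>)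
    thus ?thesis by (simp add: lower_curve8_def)
  next
    case 5
    have "(1 - f8 1 t, 1 - t) \<in> closed_segment (1/10, 3/10) (1/5, 1/2)"
      by (rule in_segment) (use 5 assms in \<open>simp_all add: f8_def\<close>)
    thus ?thesis by (simp add: lower_curve8_def)
  next
    case 6
    have "(1 - f8 1 t, 1 - t) \<in> closed_segment (0, 0) (1/10, 3/10)"
      by (rule in_segment) (use 6 assms in \<open>simp_all add: f8_def\<close>)
    thus ?thesis by (simp add: lower_curve8_def)
  qed
qed

lemma f5_scale: "v > 0 \<Longrightarrow> f5 v u = v * f5 1 (u / v)"
  by (simp add: f5_def field_simps)

lemma f5_ends: "f5 1 0 = 0" "f5 1 1 = 1"
  by (simp_all add: f5_def)

lemma f6_scale: "v > 0 \<Longrightarrow> f6 v u = v * f6 1 (u / v)"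
  by (simp add: f6_def field_simps)

lemma f6_ends: "f6 1 0 = 0" "f6 1 1 = 1"
  by (simp_all add: f6_def)

lemma f7_scale: "v > 0 \<Longrightarrow> f7 v u = v * f7 1 (u / v)"
  by (simp add: f7_def field_simps)

lemma f7_ends: "f7 1 0 = 0" "f7 1 1 = 1"
  by (simp_all add: f7_def)

lemma f8_scale: "v > 0 \<Longrightarrow> f8 v u = v * f8 1 (u / v)"
  by (simp add: f8_def field_simps)

lemma f8_ends: "f8 1 0 = 0" "f8 1 1 = 1"
  by (simp_all add: f8_def)

section \<open>The sign of the rate on the curves\<close>

text \<open>
  The inequality behind the point \<open>(3/10, 61/100)\<close> at degree \<open>7\<close>. Evaluating numbers with a thousand
  digits is avoided by grouping the factors into 30th powers: the two resulting bases have a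
  quotient just below \<open>56\<close>, and \<open>56 ^ 30\<close> fits into the remaining factors.
\<close>
lemma power_inequality_61:
  "(61::nat) ^ 366 * 70 ^ 420 < 39 ^ 39 * 30 ^ 30 * 31 ^ 217 * 100 ^ 500"
proof -
  have split: "(b::nat) ^ (k * 30 + r) = (b ^ k) ^ 30 * b ^ r" for b k r
    by (simp only: power_add power_mult)
  have pow: "(61::nat) ^ 366 = (61 ^ 12) ^ 30 * 61 ^ 6" "(70::nat) ^ 420 = (70 ^ 14) ^ 30 * 70 ^ 0"
    "(39::nat) ^ 39 = (39 ^ 1) ^ 30 * 39 ^ 9" "(31::nat) ^ 217 = (31 ^ 7) ^ 30 * 31 ^ 7"
    "(100::nat) ^ 500 = (100 ^ 16) ^ 30 * 100 ^ 20"
    unfolding split[symmetric] by (rule arg_cong[of _ _ "(^) _"], simp)+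
  have "(61::nat) ^ 366 * 70 ^ 420 = (61 ^ 12 * 70 ^ 14) ^ 30 * 61 ^ 6"
    unfolding pow power_mult_distrib by (simp only: power_0 mult_1_right mult_ac)
  also have "\<dots> \<le> (56 * (39 * 30 * 31 ^ 7 * 100 ^ 16)) ^ 30 * 61 ^ 6"
    by (intro mult_right_mono power_mono) simp_all
  also have "\<dots> = (39 * 30 * 31 ^ 7 * 100 ^ 16) ^ 30 * (56 ^ 30 * 61 ^ 6)"
    by (simp only: power_mult_distrib mult_ac)
  also have "\<dots> < (39 * 30 * 31 ^ 7 * 100 ^ 16) ^ 30 * (39 ^ 9 * 31 ^ 7 * 100 ^ 20)"
  proof (rule mult_strict_left_mono)
    show "(56::nat) ^ 30 * 61 ^ 6 < 39 ^ 9 * 31 ^ 7 * 100 ^ 20" by simp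
    show "(0::nat) < (39 * 30 * 31 ^ 7 * 100 ^ 16) ^ 30" by (rule zero_less_power) simp
  qed
  also have "\<dots> = 39 ^ 39 * 30 ^ 30 * 31 ^ 217 * 100 ^ 500"
    unfolding pow power_mult_distrib by (simp only: power_one_right mult_ac)
  finally show ?thesis .
qed

lemma breakpoint_7: "subcritical 4 (3/10, 61/100)"
proof -
  have exps: "(4 + 2) * 61 = (366::nat)" "(4 + 2) * 70 = (420::nat)" "(4 + 3) * 31 = (217::nat)"
    "(4 + 1) * 100 = (500::nat)" "100 - 30 = (70::nat)" "100 - 61 = (39::nat)" "61 - 30 = (31::nat)" by simp_all
  have "subcritical 4 (real 30 / real 100, real 61 / real 100)"
  proof (rule subcritical_by_powers)
    show "(61::nat) ^ ((4 + 2) * 61) * (100 - 30) ^ ((4 + 2) * (100 - 30))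
      < (100 - 61) ^ (100 - 61) * 30 ^ 30 * (61 - 30) ^ ((4 + 3) * (61 - 30)) * 100 ^ ((4 + 1) * 100)"
      unfolding exps by (rule power_inequality_61)
  qed simp_all
  thus ?thesis by simp
qed

text \<open>
  The breakpoints other than the origin of the four functions, up to the first one on or beyond the
  mirror line \<open>x + y = 1\<close>. An instance with \<open>u\<close>, \<open>w\<close>, \<open>v\<close>, \<open>a\<close> concerns the point
  \<open>(u / v, w / v)\<close> at degree \<open>a + 3\<close>, and its simplification evaluates the inequality between the
  powers.
\<close>
lemmas breakpoints_5 =
  subcritical_by_powers[of 3 6 20 2, simplified]
  subcritical_by_powers[of 6 10 20 2, simplified]
  subcritical_by_powers[of 10 14 20 2, simplified]

lemmas breakpoints_6 =
  subcritical_by_powers[of 2 5 20 3, simplified]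
  subcritical_by_powers[of 5 10 20 3, simplified]
  subcritical_by_powers[of 10 15 20 3, simplified]

lemmas breakpoints_7 =
  subcritical_by_powers[of 2 6 20 4, simplified]
  subcritical_by_powers[of 3 8 20 4, simplified]
  breakpoint_7
  subcritical_dual[OF breakpoint_7, simplified]

lemmas breakpoints_8 =
  subcritical_by_powers[of 1 3 10 5, simplified]
  subcritical_by_powers[of 2 5 10 5, simplified]
  subcritical_by_powers[of 1 2 3 5, simplified]

lemma subcritical_lower_curve5:
  assumes "p \<in> lower_curve5" "p \<noteq> (0, 0)"
  shows "subcritical 2 p"
proof -
  consider "p \<in> closed_segment (0, 0) (3/20, 3/10)" | "p \<in> closed_segment (3/20, 3/10) (3/10, 1/2)" | "p \<in> closed_segment (3/10, 1/2) (1/2, 7/10)"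
    using assms(1) unfolding lower_curve5_def by blast
  thus ?thesis
  proof cases
    case 1
    show ?thesis by (rule subcritical_first_segment[OF breakpoints_5(1) _ 1 assms(2)]) (simp add: power2_eq_square)
  next
    case 2
    show ?thesis by (rule subcritical_inner_segment[OF breakpoints_5(1,2) _ _ _ _ 2]) (simp_all add: power2_eq_square)
  next
    case 3
    show ?thesis by (rule subcritical_inner_segment[OF breakpoints_5(2,3) _ _ _ _ 3]) (simp_all add: power2_eq_square)
  qed
qed

lemma subcritical_lower_curve6:
  assumes "p \<in> lower_curve6" "p \<noteq> (0, 0)"
  shows "subcritical 3 p"
proof -
  consider "p \<in> closed_segment (0, 0) (1/10, 1/4)" | "p \<in> closed_segment (1/10, 1/4) (1/4, 1/2)" | "p \<in> closed_segment (1/4, 1/2) (1/2, 3/4)"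
    using assms(1) unfolding lower_curve6_def by blast
  thus ?thesis
  proof cases
    case 1
    show ?thesis by (rule subcritical_first_segment[OF breakpoints_6(1) _ 1 assms(2)]) (simp add: power2_eq_square)
  next
    case 2
    show ?thesis by (rule subcritical_inner_segment[OF breakpoints_6(1,2) _ _ _ _ 2]) (simp_all add: power2_eq_square)
  next
    case 3
    show ?thesis by (rule subcritical_inner_segment[OF breakpoints_6(2,3) _ _ _ _ 3]) (simp_all add: power2_eq_square)
  qed
qed

lemma subcritical_lower_curve7:
  assumes "p \<in> lower_curve7" "p \<noteq> (0, 0)"
  shows "subcritical 4 p"
proof -
  consider "p \<in> closed_segment (0, 0) (1/10, 3/10)" | "p \<in> closed_segment (1/10, 3/10) (3/20, 2/5)" | "p \<in> closed_segment (3/20, 2/5) (3/10, 61/100)" | "p \<in> closed_segment (3/10, 61/100) (39/100, 7/10)"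
    using assms(1) unfolding lower_curve7_def by blast
  thus ?thesis
  proof cases
    case 1
    show ?thesis by (rule subcritical_first_segment[OF breakpoints_7(1) _ 1 assms(2)]) (simp add: power2_eq_square)
  next
    case 2
    show ?thesis by (rule subcritical_inner_segment[OF breakpoints_7(1,2) _ _ _ _ 2]) (simp_all add: power2_eq_square)
  next
    case 3
    show ?thesis by (rule subcritical_inner_segment[OF breakpoints_7(2,3) _ _ _ _ 3]) (simp_all add: power2_eq_square)
  next
    case 4
    show ?thesis by (rule subcritical_inner_segment[OF breakpoints_7(3,4) _ _ _ _ 4]) (simp_all add: power2_eq_square)
  qed
qed

lemma subcritical_lower_curve8:
  assumes "p \<in> lower_curve8" "p \<noteq> (0, 0)"
  shows "subcritical 5 p"
proof -
  consider "p \<in> closed_segment (0, 0) (1/10, 3/10)" | "p \<in> closed_segment (1/10, 3/10) (1/5, 1/2)" | "p \<in> closed_segment (1/5, 1/2) (1/3, 2/3)"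
    using assms(1) unfolding lower_curve8_def by blast
  thus ?thesis
  proof cases
    case 1
    show ?thesis by (rule subcritical_first_segment[OF breakpoints_8(1) _ 1 assms(2)]) (simp add: power2_eq_square)
  next
    case 2
    show ?thesis by (rule subcritical_inner_segment[OF breakpoints_8(1,2) _ _ _ _ 2]) (simp_all add: power2_eq_square)
  next
    case 3
    show ?thesis by (rule subcritical_inner_segment[OF breakpoints_8(2,3) _ _ _ _ 3]) (simp_all add: power2_eq_square)
  qed
qed

theorem theorem1:
  "\<forall>d \<in> {5, 6, 7, 8 :: nat}. \<exists>v0 :: nat. \<forall>v \<ge> v0. v > 0 \<longrightarrow>
     (\<exists>(G :: nat multigraph) V W.
        multigraph G \<and> bipartite G V W \<and> regular G d \<and>
        card (nodes G) = 2 * v \<and> card V = v \<and> card W = v \<and>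
        (\<forall>U. U \<subseteq> V \<or> U \<subseteq> W \<longrightarrow>
           real (card (neighbours G U)) \<ge> f d (real v) (real (card U))))"
proof
  fix d :: nat assume "d \<in> {5, 6, 7, 8}"
  then consider "d = 5" | "d = 6" | "d = 7" | "d = 8" by auto
  thus "\<exists>v0 :: nat. \<forall>v \<ge> v0. v > 0 \<longrightarrow>
     (\<exists>(G :: nat multigraph) V W.
        multigraph G \<and> bipartite G V W \<and> regular G d \<and>
        card (nodes G) = 2 * v \<and> card V = v \<and> card W = v \<and>
        (\<forall>U. U \<subseteq> V \<or> U \<subseteq> W \<longrightarrow>
           real (card (neighbours G U)) \<ge> f d (real v) (real (card U))))"
  proof cases
    case 1
    hence eqs: "d = 2 + 3" "f (2 + 3) = f5" by (simp_all add: f_def)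
    show ?thesis unfolding eqs
      by (rule expanding_multigraph[OF _ compact_lower_curve5 subcritical_lower_curve5 f5_on_lower_curve_or_mirror
            f5_ends f5_scale]) simp_all
  next
    case 2
    hence eqs: "d = 3 + 3" "f (3 + 3) = f6" by (simp_all add: f_def)
    show ?thesis unfolding eqs
      by (rule expanding_multigraph[OF _ compact_lower_curve6 subcritical_lower_curve6 f6_on_lower_curve_or_mirror
            f6_ends f6_scale]) simp_all
  next
    case 3
    hence eqs: "d = 4 + 3" "f (4 + 3) = f7" by (simp_all add: f_def)
    show ?thesis unfolding eqs
      by (rule expanding_multigraph[OF _ compact_lower_curve7 subcritical_lower_curve7 f7_on_lower_curve_or_mirror
            f7_ends f7_scale]) simp_all
  next
    case 4
    hence eqs: "d = 5 + 3" "f (5 + 3) = f8" by (simp_all add: f_def)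
    show ?thesis unfolding eqs
      by (rule expanding_multigraph[OF _ compact_lower_curve8 subcritical_lower_curve8 f8_on_lower_curve_or_mirror
            f8_ends f8_scale]) simp_all
  qed
qed

end
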